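(* Let $n$, $r$, $s$ and $t$ be positive integers, and let $R$, $S$ be subsets of $[n]$ with $t\leq \min (R\cup S)$, $r=\max R$, $s=\max S$ and $r+s-t<n$. If $\mathcal{A}\subseteq\binom{[n]}{R}$ and $\mathcal{B}\subseteq \binom{[n]}{S}$ are non-empty cross $t$-intersecting, then $$|\mathcal{A}|+|\mathcal{B}|\leq \max\left\{ 1+ \sum_{i\in S}\sum_{j=t}^{i}\binom{r}{j}\binom{n-r}{i-j},\ 1+\sum_{i\in R}\sum_{j=t}^{i}\binom{s}{j}\binom{n-s}{i-j} \right\}.\qquad ( * )$$ Moreover, the following hold. (1) If $R=S$ and $2r<n$, then equality holds in $( * )$ if and only if one of the following holds: (i) $\mathcal{A}=\{A\}$ and $\mathcal{B}=\{B\in\binom{[n]}{S}: |B\cap A|\geq t\}$ for some $A\in\binom{[n]}{r}$; (ii) $\mathcal{B}=\{B\}$ and $\mathcal{A}=\{A\in\binom{[n]}{R}: |A\cap B|\geq t\}$ for some $B\in\binom{[n]}{s}$; (iii) $R=S=\{1,2\}$ and $\mathcal{A}=\mathcal{B}=\{C\in\binom{[n]}{[2]}: i\in C\}$ for some $i\in[n]$; (iv) $R=S=\{2\}$ and $\mathcal{A}=\mathcal{B}=\{C\in\binom{[n]}{2}: i\in C\}$ for some $i\in[n]$. (2) If $R\neq S$ and $\max\{2^{s+1}|R|(s-t)+2r+1,\ 2^{r+1}|S|(r-t)+2s+1\}\leq n$, then equality holds in $( * )$ if and only if one of the following holds: (i) $\max (R\bigtriangleup S)\in S$, and $\mathcal{A}=\{A\}$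 and $\mathcal{B}=\{B\in\binom{[n]}{S}: |B\cap A|\geq t\}$ for some $A\in\binom{[n]}{r}$; (ii) $\max (R\bigtriangleup S)\in R$, and $\mathcal{B}=\{B\}$ and $\mathcal{A}=\{A\in\binom{[n]}{R}: |A\cap B|\geq t\}$ for some $B\in\binom{[n]}{s}$.
   Context: $[n]=\{1,2,\ldots,n\}$. $\binom{[n]}{k}$ is the family of all $k$-element subsets of $[n]$, and for $M\subseteq[n]$, $\binom{[n]}{M}=\bigcup_{m\in M}\binom{[n]}{m}$. Two families $\mathcal{A}\subseteq\binom{[n]}{R}$ and $\mathcal{B}\subseteq\binom{[n]}{S}$ are non-empty cross $t$-intersecting if both are non-empty and $|A\cap B|\geq t$ for all $A\in\mathcal{A}$ and $B\in\mathcal{B}$. $R\bigtriangleup S$ denotes the symmetric difference. Since $r=\max R$ and $s=\max S$, the sets $R,S$ are non-empty. Binomial coefficients $\binom{a}{b}$ with $b>a\ge 0$ are $0$. *)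

theory Defs
  imports Complex_Main "HOL-Library.Ramsey"
begin

text \<open>The family of all subsets of \<open>[n] = {1..n}\<close> whose size lies in \<open>M\<close>;
  \<open>[{1..n}]\<^bsup>m\<^esup>\<close>, i.e. \<open>nsets {1..n} m\<close>, is the family of all \<open>m\<close>-element subsets.\<close>

definition layers :: "nat \<Rightarrow> nat set \<Rightarrow> nat set set" where
  "layers n M = (\<Union>m\<in>M. nsets {1..n} m)"

definition nonempty_cross_intersecting ::
    "nat \<Rightarrow> nat set set \<Rightarrow> nat set set \<Rightarrow> bool" where
  "nonempty_cross_intersecting t \<A> \<B> \<longleftrightarrow>
     \<A> \<noteq> {} \<and> \<B> \<noteq> {} \<and> (\<forall>A\<in>\<A>. \<forall>B\<in>\<B>. t \<le> card (A \<inter> B))"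

text \<open>One of the two terms of the extremal bound. All truncated subtractions are harmless
  where it is used: \<open>j \<le> i\<close> in the sum, and \<open>k \<le> n\<close> for \<open>k = Max R\<close>, \<open>k = Max S\<close>.\<close>

definition bound_term :: "nat \<Rightarrow> nat \<Rightarrow> nat \<Rightarrow> nat set \<Rightarrow> nat" where
  "bound_term n t k M = 1 + (\<Sum>i\<in>M. \<Sum>j=t..i. (k choose j) * ((n - k) choose (i - j)))"

end

theory Submission
  imports Defs "HOL-Combinatorics.Transposition"
begin

text \<open>Replace \<open>\<B>\<close> by the set of all common partners of \<open>\<A>\<close> and call the resulting sum of sizes
  the total of \<open>\<A>\<close>; it is supermodular and invariant under permutations of \<open>[n]\<close>. Hence, if \<open>\<A>\<close>
  has maximal total and at most as many members as partners, every nonempty intersection of \<open>\<A>\<close>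
  with its image under a transposition also has maximal total. A smallest such \<open>\<A>\<close> is therefore
  fixed by each transposition that fixes one of its members, which forces \<open>\<A>\<close> to be a singleton
  and yields the bound. For the case of equality the same argument is applied to a smallest such
  \<open>\<A>\<close> with at least two members: a transposition that fixes a member of \<open>\<A>\<close> but not \<open>\<A>\<close> fixes
  no other member. So \<open>[n]\<close> splits into two classes of interchangeable points, and counting the
  partners lost when passing from one member to all of \<open>\<A>\<close> leaves only the stars with \<open>s = 2\<close>.
  If \<open>R \<noteq> S\<close>, the hypothesis on \<open>n\<close> makes one of the two bounds strictly larger.\<close>

section \<open>Counting\<close>

text \<open>Such a \<open>B\<close> is the disjoint union of \<open>B \<inter> U\<close> and
  \<open>B - U\<close>, which can be chosen independently.\<close>

lemma card_subsets_meeting_in: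
  assumes "finite W" "U \<subseteq> W" "j \<le> i"
  shows "card {B. B \<subseteq> W \<and> card B = i \<and> card (B \<inter> U) = j}
    = (card U choose j) * (card (W - U) choose (i - j))"
proof -
  have fin: "finite U" "finite (W - U)"
    using assms finite_subset by auto
  let ?P = "{E. E \<subseteq> U \<and> card E = j} \<times> {F. F \<subseteq> W - U \<and> card F = i - j}"
  let ?f = "\<lambda>(E, F). E \<union> F"
  have split: "(E \<union> F) \<inter> U = E" "(E \<union> F) - U = F" if "E \<subseteq> U" "F \<subseteq> W - U" for E F
    using that by auto
  have inj: "inj_on ?f ?P"
    by (rule inj_onI) (clarsimp, metis split)
  have "?f ` ?P = {B. B \<subseteq> W \<and> card B = i \<and> card (B \<inter> U) = j}"
  proof (intro equalityI subsetI)
    fix B assume "B \<in> ?f ` ?P"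
    then obtain E F where EF: "B = E \<union> F" "E \<subseteq> U" "card E = j" "F \<subseteq> W - U" "card F = i - j"
      by auto
    moreover have "card (E \<union> F) = card E + card F"
      using EF fin by (intro card_Un_disjoint) (auto intro: finite_subset)
    ultimately show "B \<in> {B. B \<subseteq> W \<and> card B = i \<and> card (B \<inter> U) = j}"
      using assms split[of E F] by auto
  next
    fix B assume B: "B \<in> {B. B \<subseteq> W \<and> card B = i \<and> card (B \<inter> U) = j}"
    then have "finite B"
      using assms finite_subset by auto
    then have "card (B \<inter> U) + card (B - U) = card B"
      by (metis Int_Diff_Un Int_Diff_disjoint card_Un_disjoint finite_Diff finite_Int)
    then have "(B \<inter> U, B - U) \<in> ?P"
      using B by auto
    then show "B \<in> ?f ` ?P"
      by (rule rev_image_eqI) auto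
  qed
  then have "card {B. B \<subseteq> W \<and> card B = i \<and> card (B \<inter> U) = j} = card ?P"
    using card_image[OF inj] by simp
  also have "\<dots> = (card U choose j) * (card (W - U) choose (i - j))"
    using fin by (simp add: card_cartesian_product n_subsets)
  finally show ?thesis .
qed

lemma binomial_ge_top:
  assumes "1 \<le> k" "k < N"
  shows "N \<le> N choose k"
  using assms
proof (induction N arbitrary: k)
  case (Suc N)
  obtain k' where k: "k = Suc k'"
    using Suc.prems by (cases k) auto
  show ?case
  proof (cases "k = N")
    case False
    then have "N \<le> N choose k"
      using Suc by simp
    moreover have "0 < N choose k'"
      using Suc.prems k by simp
    ultimately show ?thesis
      unfolding k binomial_Suc_Suc by linarith
  qed simp
qed simp

text \<open>By Pascal's rule and \<open>binomial_ge_top\<close> the coefficient is at least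
  \<open>2 * (N - 1)\<close>, which exceeds \<open>N + 1\<close> from \<open>N = 4\<close>
  on.\<close>

lemma binomial_gt_Suc_top:
  assumes "2 \<le> k" "k + 2 \<le> N" "4 \<le> N"
  shows "N + 1 < N choose k"
proof -
  obtain N' k' where eq: "N = Suc N'" "k = Suc k'"
    using assms by (cases N; cases k) auto
  have "N' \<le> N' choose k'" "N' \<le> N' choose k"
    using assms eq by (auto intro!: binomial_ge_top)
  then show ?thesis
    using assms eq by simp
qed

lemma mem_layers_iff: "B \<in> layers n M \<longleftrightarrow> B \<subseteq> {1..n} \<and> card B \<in> M"
  unfolding layers_def nsets_def using finite_subset by fastforce

lemma finite_layers: "finite (layers n M)"
  by (rule finite_subset[of _ "Pow {1..n}"]) (auto simp only: mem_layers_iff Pow_iff finite_Pow_iff finite_atLeastAtMost)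

text \<open>The largest family inside \<open>layers n M\<close> that can stand opposite
  \<open>\<F>\<close>. The layer set is a parameter because partners are taken in \<open>S\<close>
  and, with the roles exchanged, in \<open>R\<close>.\<close>

definition partners :: "nat \<Rightarrow> nat \<Rightarrow> nat set \<Rightarrow> nat set set \<Rightarrow> nat set set" where
  "partners n t M \<F> = {B \<in> layers n M. \<forall>A\<in>\<F>. t \<le> card (A \<inter> B)}"

lemma finite_partners: "finite (partners n t M \<F>)"
  using finite_layers by (simp add: partners_def)

lemma partners_antimono: "\<F> \<subseteq> \<G> \<Longrightarrow> partners n t M \<G> \<subseteq> partners n t M \<F>"
  by (auto simp: partners_def)

lemma partners_Un: "partners n t M (\<F> \<union> \<G>) = partners n t M \<F> \<inter> partners n t M \<G>"
  by (auto simp: partners_def)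

text \<open>Sorting the partners by their size \<open>i\<close> and by
  \<open>j = card (B \<inter> C)\<close> gives the double sum. The summand 1 counts \<open>C\<close>
  itself, so \<open>bound_term\<close> is the total of a singleton.\<close>

lemma card_partners_singleton:
  assumes C: "C \<subseteq> {1..n}" and M: "finite M"
  shows "1 + card (partners n t M {C}) = bound_term n t (card C) M"
proof -
  let ?L = "\<lambda>i j. {B. B \<subseteq> {1..n} \<and> card B = i \<and> card (B \<inter> C) = j}"
  have fin: "finite (?L i j)" for i j
    by (rule finite_subset[of _ "Pow {1..n}"]) auto
  have le: "card (B \<inter> C) \<le> card B" if "B \<subseteq> {1..n}" for B
    using that finite_subset by (intro card_mono) auto
  have "partners n t M {C} = (\<Union>i\<in>M. \<Union>j\<in>{t..i}. ?L i j)"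
    using le by (auto simp: partners_def mem_layers_iff Int_commute)
  also have "card \<dots> = (\<Sum>i\<in>M. card (\<Union>j\<in>{t..i}. ?L i j))"
    using M fin by (subst card_UN_disjoint) auto
  also have "\<dots> = (\<Sum>i\<in>M. \<Sum>j=t..i. card (?L i j))"
    using fin by (intro sum.cong refl, subst card_UN_disjoint) auto
  also have "\<dots> = (\<Sum>i\<in>M. \<Sum>j=t..i. (card C choose j) * ((n - card C) choose (i - j)))"
    using C by (intro sum.cong refl) (auto simp: card_subsets_meeting_in card_Diff_subset finite_subset)
  finally show ?thesis
    by (simp add: bound_term_def)
qed

section \<open>Transpositions\<close>

lemma card_image_transpose [simp]: "card (transpose x y ` A) = card A"
  by (simp add: card_image)

lemma image_transpose_twice [simp]: "transpose x y ` transpose x y ` A = A"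
  by (simp add: image_image)

lemma image_transpose_Int: "transpose x y ` A \<inter> B = transpose x y ` (A \<inter> transpose x y ` B)"
  by (metis image_Int image_transpose_twice inj_on_transpose)

lemma card_image_transpose_Int: "card (transpose x y ` A \<inter> B) = card (A \<inter> transpose x y ` B)"
  by (metis image_transpose_Int card_image_transpose)

lemma image_transpose_subset_iff:
  assumes "x \<in> U" "y \<in> U"
  shows "transpose x y ` A \<subseteq> U \<longleftrightarrow> A \<subseteq> U"
proof -
  have "transpose x y ` U = U"
    using assms by simp
  then show ?thesis
    by (metis image_mono image_transpose_twice)
qed

lemma image_transpose_member:
  assumes "x \<in> A" "y \<notin> A"
  shows "transpose x y ` A = insert y (A - {x})"
  using assms by (auto simp: transpose_def image_def)

lemma inj_image_transpose: "inj_on ((`) (transpose x y)) \<F>"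
  by (rule inj_onI) (metis image_transpose_twice)

lemma image_transpose_layers:
  assumes "x \<in> {1..n}" "y \<in> {1..n}"
  shows "transpose x y ` B \<in> layers n M \<longleftrightarrow> B \<in> layers n M"
  using assms by (simp only: mem_layers_iff image_transpose_subset_iff card_image_transpose)

text \<open>A transposition is an involution, so when sizes of intersections are compared it can be
  moved from one set to the other.\<close>

lemma partners_image_transpose:
  assumes "x \<in> {1..n}" "y \<in> {1..n}"
  shows "partners n t M ((`) (transpose x y) ` \<F>) = (`) (transpose x y) ` partners n t M \<F>"
proof -
  have iff: "B \<in> partners n t M ((`) (transpose x y) ` \<F>) \<longleftrightarrow> transpose x y ` B \<in> partners n t M \<F>" for B
    using assms by (simp add: partners_def image_transpose_layers card_image_transpose_Int del: atLeastAtMost_iff)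
  show ?thesis
  proof (intro equalityI subsetI)
    fix B assume "B \<in> partners n t M ((`) (transpose x y) ` \<F>)"
    then show "B \<in> (`) (transpose x y) ` partners n t M \<F>"
      using iff by (metis image_eqI image_transpose_twice)
  qed (auto simp: iff)
qed

text \<open>One inclusion expresses full invariance under the swap, because a transposition is an
  involution.\<close>

definition interchangeable :: "nat set set \<Rightarrow> nat \<Rightarrow> nat \<Rightarrow> bool" where
  "interchangeable \<F> x y \<longleftrightarrow> (\<forall>A\<in>\<F>. transpose x y ` A \<in> \<F>)"

lemma interchangeable_refl: "interchangeable \<F> x x"
  by (simp add: interchangeable_def)

lemma interchangeable_sym: "interchangeable \<F> x y \<Longrightarrow> interchangeable \<F> y x"
  by (simp add: interchangeable_def transpose_commute)

text \<open>Conjugation: for \<open>z\<close> distinct from \<open>x\<close> and \<open>y\<close>,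
  \<open>transpose x z\<close> is the composition of \<open>transpose x y\<close>,
  \<open>transpose y z\<close> and \<open>transpose x y\<close>.\<close>

lemma interchangeable_trans:
  assumes "interchangeable \<F> x y" "interchangeable \<F> y z"
  shows "interchangeable \<F> x z"
proof (cases "x = z \<or> y = z")
  case False
  have "transpose x z ` A \<in> \<F>" if "A \<in> \<F>" for A
  proof -
    have "transpose x y ` transpose y z ` transpose x y ` A = transpose x z ` A"
      using False transpose_comp_triple[of x z y] by (metis image_comp)
    then show ?thesis
      using assms that by (metis interchangeable_def)
  qed
  then show ?thesis
    by (simp add: interchangeable_def)
qed (use assms interchangeable_refl in auto)

section \<open>Optimal families\<close>

text \<open>\<open>r\<close> and \<open>s\<close> enter as attained upper bounds, so the assumptions
  are symmetric in \<open>(r, R)\<close> and \<open>(s, S)\<close>. \<open>sum_less\<close> is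
  \<open>r + s - t < n\<close> without truncated subtraction.\<close>

locale layer_pair =
  fixes n t r s :: nat and R S :: "nat set"
  assumes t_pos: "0 < t"
    and r_in: "r \<in> R" and s_in: "s \<in> S"
    and R_range: "\<And>i. i \<in> R \<Longrightarrow> t \<le> i \<and> i \<le> r"
    and S_range: "\<And>i. i \<in> S \<Longrightarrow> t \<le> i \<and> i \<le> s"
    and sum_less: "r + s < n + t"
begin

lemma swap: "layer_pair n t s r S R"
  using t_pos r_in s_in R_range S_range sum_less by unfold_locales auto

lemma t_le_r: "t \<le> r" and t_le_s: "t \<le> s" and r_less: "r < n" and s_less: "s < n"
  using R_range[OF r_in] S_range[OF s_in] sum_less by auto

lemma finite_R: "finite R" and finite_S: "finite S"
  using R_range S_range by (meson finite_nat_set_iff_bounded_le)+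

lemma layers_card: "C \<in> layers n R \<Longrightarrow> t \<le> card C \<and> card C \<le> r"
  using R_range by (simp add: mem_layers_iff)

lemma layers_subset: "C \<in> layers n R \<Longrightarrow> C \<subseteq> {1..n}"
  by (simp only: mem_layers_iff)

lemma layers_finite: "C \<in> layers n R \<Longrightarrow> finite C"
  by (metis finite_atLeastAtMost finite_subset mem_layers_iff)

lemma layers_nonempty: "C \<in> layers n R \<Longrightarrow> C \<noteq> {}"
  using layers_card t_pos by fastforce

lemma layers_proper: "C \<in> layers n R \<Longrightarrow> \<exists>x\<in>{1..n}. x \<notin> C"
proof (rule ccontr)
  assume C: "C \<in> layers n R" and "\<not> (\<exists>x\<in>{1..n}. x \<notin> C)"
  then have "card {1..n} \<le> card C"
    by (intro card_mono layers_finite) auto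
  then show False
    using layers_card[OF C] r_less by simp
qed

text \<open>A \<open>t\<close>-set \<open>T\<close> inside \<open>C\<close> that contains a point
  outside \<open>D\<close> meets \<open>D\<close> in fewer than \<open>t\<close> points; it remains
  to extend \<open>T\<close> to size \<open>s\<close> while keeping the intersection with
  \<open>D\<close> small. This is the source of strict gains of partners.\<close>

lemma exists_separating:
  assumes C: "C \<subseteq> {1..n}" "t \<le> card C" and D: "D \<subseteq> {1..n}" "card D \<le> r" and "\<not> C \<subseteq> D"
  shows "\<exists>B\<in>layers n S. t \<le> card (C \<inter> B) \<and> card (D \<inter> B) < t"
proof -
  obtain c where c: "c \<in> C" "c \<notin> D"
    using assms by auto
  have fin: "finite C" "finite D"
    using C D finite_subset by auto
  have "t - 1 \<le> card (C - {c})"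
    using C c by simp
  then obtain T0 where T0: "T0 \<subseteq> C - {c}" "card T0 = t - 1" "finite T0"
    by (rule obtain_subset_with_card_n)
  define T where "T = insert c T0"
  have T: "T \<subseteq> C" "card T = t" "finite T" "c \<in> T"
    using T0 c t_pos by (auto simp: T_def card_insert_if)
  have DT: "card (D \<inter> T) < t"
    using T c psubset_card_mono[of T "D \<inter> T"] by auto
  define W where "W = {1..n} - (T \<union> D)"
  have CB: "t \<le> card (C \<inter> B)" if "T \<subseteq> B" for B
    using T fin that card_mono[of "C \<inter> B" T] by auto
  have card_Un_T: "card (T \<union> E) = s" if "E \<subseteq> {1..n} - T" "card E = s - t" for E
  proof -
    have "finite E" using that finite_subset by auto
    then have "card (T \<union> E) = card T + card E"
      using that T by (intro card_Un_disjoint) auto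
    then show ?thesis using that T t_le_s by simp
  qed
  show ?thesis
  proof (cases "s - t \<le> card W")
    case True
    then obtain E where E: "E \<subseteq> W" "card E = s - t"
      by (meson obtain_subset_with_card_n)
    have "D \<inter> (T \<union> E) = D \<inter> T"
      using E by (auto simp: W_def)
    then show ?thesis
      using E T C DT CB[of "T \<union> E"] card_Un_T[of E] s_in
      by (intro bexI[of _ "T \<union> E"]) (auto simp: mem_layers_iff W_def)
  next
    case False
    \<comment> \<open>Too few points lie outside \<open>T\<close> and \<open>D\<close>. Taking all
      of them makes the extended set and \<open>D\<close> cover \<open>[n]\<close>, and
      inclusion-exclusion leaves at most \<open>r + s - n < t\<close> common points.\<close>
    have cardT: "card ({1..n} - T) = n - t"
      using T C by (subst card_Diff_subset) auto
    have "\<exists>E. W \<subseteq> E \<and> E \<subseteq> {1..n} - T \<and> card E = s - t"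
      using False s_less cardT by (intro exists_subset_between) (auto simp: W_def)
    then obtain E where E: "W \<subseteq> E" "E \<subseteq> {1..n} - T" "card E = s - t"
      by auto
    have cov: "D \<union> (T \<union> E) = {1..n}"
      using E T C D by (auto simp: W_def)
    have "finite (T \<union> E)"
      using cov finite_subset[of "T \<union> E" "{1..n}"] by auto
    then have "card D + s = n + card (D \<inter> (T \<union> E))"
      using card_Un_Int[of D "T \<union> E"] card_Un_T[of E] E fin cov by simp
    then have "card (D \<inter> (T \<union> E)) < t"
      using D sum_less by linarith
    moreover have "T \<union> E \<subseteq> {1..n}"
      using cov by blast
    ultimately show ?thesis
      using E CB[of "T \<union> E"] card_Un_T[of E] s_in
      by (intro bexI[of _ "T \<union> E"]) (auto simp: mem_layers_iff)
  qed
qed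

text \<open>Fix a partner \<open>B\<close> and a member \<open>C\<close> meeting it least. As
  \<open>C\<close> and \<open>B\<close> share at least \<open>t\<close> points, they leave some
  \<open>y\<close> uncovered; swapping a common point with \<open>y\<close> would give a member
  meeting \<open>B\<close> even less.\<close>

lemma not_all_interchangeable:
  assumes F: "F \<subseteq> layers n R" "F \<noteq> {}" "partners n t S F \<noteq> {}"
  shows "\<exists>x\<in>{1..n}. \<exists>y\<in>{1..n}. \<not> interchangeable F x y"
proof (rule ccontr)
  assume all: "\<not> ?thesis"
  obtain B where B: "B \<in> partners n t S F"
    using F by auto
  have B': "B \<subseteq> {1..n}" "card B \<le> s" "finite B"
    using B S_range finite_subset by (auto simp: partners_def mem_layers_iff)
  obtain C0 where "C0 \<in> F"
    using F by auto
  then obtain C where C: "C \<in> F" and min: "\<And>D. D \<in> F \<Longrightarrow> card (C \<inter> B) \<le> card (D \<inter> B)"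
    using ex_has_least_nat[of "\<lambda>C. C \<in> F" C0 "\<lambda>C. card (C \<inter> B)"] by blast
  have C': "C \<in> layers n R" "finite C" "C \<subseteq> {1..n}" "card C \<le> r"
    using C F layers_finite layers_card layers_subset by blast+
  have tC: "t \<le> card (C \<inter> B)"
    using B C by (auto simp: partners_def)
  then obtain x where x: "x \<in> C" "x \<in> B"
    using t_pos by (metis IntE all_not_in_conv card.empty leD)
  have "card (C \<union> B) < n"
    using card_Un_Int[of C B] C' B' tC sum_less by linarith
  then obtain y where y: "y \<in> {1..n}" "y \<notin> C" "y \<notin> B"
    using C' B' card_mono[of "C \<union> B" "{1..n}"] by fastforce
  have "insert y (C - {x}) \<in> F"
  proof -
    have "x \<in> {1..n}"
      using x C' by blast
    then show ?thesis
      using all y C image_transpose_member[OF x(1) y(2)] unfolding interchangeable_def by metis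
  qed
  moreover have "insert y (C - {x}) \<inter> B = (C \<inter> B) - {x}"
    using y by auto
  moreover have "card ((C \<inter> B) - {x}) < card (C \<inter> B)"
    using x C' by (intro psubset_card_mono) auto
  ultimately show False
    using min by (metis leD)
qed

section \<open>Totals, optimality and lightness\<close>

definition total :: "nat set set \<Rightarrow> nat" where
  "total F = card F + card (partners n t S F)"

definition feasible :: "nat set set \<Rightarrow> bool" where
  "feasible F \<longleftrightarrow> F \<subseteq> layers n R \<and> F \<noteq> {} \<and> partners n t S F \<noteq> {}"

definition optimal :: "nat set set \<Rightarrow> bool" where
  "optimal F \<longleftrightarrow> feasible F \<and> (\<forall>G. feasible G \<longrightarrow> total G \<le> total F)"

text \<open>For an optimal \<open>F\<close> this is a normalisation: if it fails, it holds for the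
  partner family after exchanging \<open>R\<close> and \<open>S\<close>.\<close>

definition light :: "nat set set \<Rightarrow> bool" where
  "light F \<longleftrightarrow> card F \<le> card (partners n t S F)"

lemma feasible_finite: "feasible F \<Longrightarrow> finite F"
  using finite_layers finite_subset by (auto simp: feasible_def)

lemma feasible_pos: "feasible F \<Longrightarrow> 0 < card F \<and> 0 < card (partners n t S F)"
  using feasible_finite finite_partners by (auto simp: feasible_def card_gt_0_iff)

text \<open>\<open>partners\<close> turns a union into an intersection, and an intersection into a
  family containing the union. So the members contribute an equality and the partners the
  inequality.\<close>

lemma total_supermodular:
  assumes "finite F" "finite G"
  shows "total F + total G \<le> total (F \<union> G) + total (F \<inter> G)"
proof -
  have "card (partners n t S F \<union> partners n t S G) \<le> card (partners n t S (F \<inter> G))"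
    by (intro card_mono finite_partners Un_least partners_antimono) auto
  then show ?thesis
    using card_Un_Int[OF assms] card_Un_Int[OF finite_partners finite_partners, of n t S F n t S G]
    by (simp add: total_def partners_Un)
qed

lemma total_image_transpose:
  assumes "x \<in> {1..n}" "y \<in> {1..n}"
  shows "total ((`) (transpose x y) ` F) = total F"
  using assms by (simp add: total_def partners_image_transpose card_image inj_image_transpose del: atLeastAtMost_iff)

lemma light_subset:
  assumes "light F" "G \<subseteq> F" "finite F"
  shows "light G"
proof -
  have "card G \<le> card F"
    using assms by (simp add: card_mono)
  also have "\<dots> \<le> card (partners n t S F)"
    using assms by (simp add: light_def)
  also have "\<dots> \<le> card (partners n t S G)"
    using assms by (intro card_mono finite_partners partners_antimono)
  finally show ?thesis
    by (simp add: light_def)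
qed

text \<open>If the union with the image has no partner left, its total is its own size, which
  lightness keeps below twice the optimum.\<close>

lemma optimal_Int_image_transpose:
  assumes F: "optimal F" "light F" and xy: "x \<in> {1..n}" "y \<in> {1..n}"
    and ne: "F \<inter> (`) (transpose x y) ` F \<noteq> {}"
  shows "optimal (F \<inter> (`) (transpose x y) ` F)" "light (F \<inter> (`) (transpose x y) ` F)"
proof -
  let ?G = "(`) (transpose x y) ` F"
  have fin: "finite F" "finite ?G"
    using F feasible_finite by (auto simp: optimal_def)
  have G: "?G \<subseteq> layers n R" "card ?G = card F"
    using F xy by (auto simp: optimal_def feasible_def image_transpose_layers card_image inj_image_transpose
        simp del: atLeastAtMost_iff)
  have feas: "feasible (F \<inter> ?G)"
    using F ne partners_antimono[of "F \<inter> ?G" F n t S] by (auto simp: optimal_def feasible_def)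
  have "total F \<le> total (F \<inter> ?G)"
  proof (cases "partners n t S (F \<union> ?G) = {}")
    case True
    have "total (F \<union> ?G) \<le> total F"
      using True card_Un_le[of F ?G] F G by (simp add: total_def light_def)
    then show ?thesis
      using total_supermodular[OF fin] total_image_transpose[OF xy, of F] by linarith
  next
    case False
    then have "feasible (F \<union> ?G)"
      using F G by (auto simp: optimal_def feasible_def)
    then have "total (F \<union> ?G) \<le> total F"
      using F by (auto simp: optimal_def)
    then show ?thesis
      using total_supermodular[OF fin] total_image_transpose[OF xy, of F] by linarith
  qed
  then show "optimal (F \<inter> ?G)"
    using feas F by (force simp: optimal_def)
  show "light (F \<inter> ?G)"
    using light_subset F fin by blast
qed

lemma interchangeable_if_subset_image:
  "F \<subseteq> (`) (transpose x y) ` F \<Longrightarrow> interchangeable F x y"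
  unfolding interchangeable_def using image_transpose_twice by fastforce

text \<open>A set that does not separate \<open>x\<close> and \<open>y\<close> is fixed by their
  transposition; such sets keep the intersection with the image nonempty.\<close>

lemma unseparated_in_Int_image:
  assumes "C \<in> F" "x \<in> C \<longleftrightarrow> y \<in> C"
  shows "C \<in> F \<inter> (`) (transpose x y) ` F"
  using assms rev_image_eqI[of C F C "(`) (transpose x y)"] by simp

text \<open>\<open>C\<close> makes all points inside it interchangeable, and likewise all points
  outside it. As \<open>D\<close> is neither \<open>C\<close> nor its complement, it fails to
  separate some \<open>a\<close> in \<open>C\<close> from some \<open>b\<close> outside, and this
  pair links the two blocks.\<close>

lemma all_interchangeable:
  assumes F: "F \<subseteq> layers n R" and CD: "C \<in> F" "D \<in> F" "D \<noteq> C" "D \<noteq> {1..n} - C"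
    and unsep: "\<And>A x y. A \<in> F \<Longrightarrow> x \<in> {1..n} \<Longrightarrow> y \<in> {1..n} \<Longrightarrow> x \<in> A \<longleftrightarrow> y \<in> A \<Longrightarrow> interchangeable F x y"
    and xy: "x \<in> {1..n}" "y \<in> {1..n}"
  shows "interchangeable F x y"
proof -
  have sub: "C \<subseteq> {1..n}" "D \<subseteq> {1..n}"
    using F CD mem_layers_iff by blast+
  obtain a0 b0 where ab0: "a0 \<in> C" "b0 \<in> {1..n}" "b0 \<notin> C"
    using F CD layers_nonempty layers_proper by blast
  have "\<exists>a\<in>C. \<exists>b\<in>{1..n} - C. a \<in> D \<longleftrightarrow> b \<in> D"
  proof (rule ccontr)
    assume "\<not> ?thesis"
    then have sep: "\<And>a b. a \<in> C \<Longrightarrow> b \<in> {1..n} - C \<Longrightarrow> a \<in> D \<longleftrightarrow> b \<notin> D"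
      by blast
    show False
    proof (cases "a0 \<in> D")
      case True
      then have "D = C"
        using sep ab0 sub by blast
      then show False using CD by simp
    next
      case False
      then have "D = {1..n} - C"
        using sep ab0 sub by blast
      then show False using CD by simp
    qed
  qed
  then obtain a b where ab: "a \<in> C" "b \<in> {1..n}" "b \<notin> C" "a \<in> D \<longleftrightarrow> b \<in> D"
    by blast
  have a: "a \<in> {1..n}"
    using ab sub by blast
  have "interchangeable F z a" if z: "z \<in> {1..n}" for z
  proof (cases "z \<in> C")
    case True
    then show ?thesis
      using unsep[OF CD(1) z a] ab by blast
  next
    case False
    then have "interchangeable F z b"
      using unsep[OF CD(1) z ab(2)] ab by blast
    then show ?thesis
      using unsep[OF CD(2) ab(2) a] ab interchangeable_trans by blast
  qed
  then show ?thesis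
    using xy interchangeable_trans interchangeable_sym by blast
qed

text \<open>Separating \<open>C\<close> from the empty set yields a partner.\<close>

lemma feasible_singleton: "C \<in> layers n R \<Longrightarrow> feasible {C}"
  using exists_separating[of C "{}"] layers_card[of C] layers_nonempty[of C] t_pos
  by (auto simp: feasible_def mem_layers_iff partners_def)

text \<open>Passing from \<open>F\<close> to \<open>{C}\<close> loses \<open>card F - 1\<close>
  members and gains every set in \<open>K\<close> as a partner. Optimality bounds this gain by the
  loss.\<close>

lemma card_killed_less:
  assumes F: "optimal F" and C: "C \<in> F"
    and K: "K \<subseteq> partners n t S {C}" "K \<inter> partners n t S F = {}"
  shows "card K < card F"
proof -
  have "feasible {C}"
    using F C by (intro feasible_singleton) (auto simp: optimal_def feasible_def)
  then have "total {C} \<le> total F"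
    using F by (auto simp: optimal_def)
  moreover have "card (K \<union> partners n t S F) \<le> card (partners n t S {C})"
    using K C by (intro card_mono finite_partners Un_least partners_antimono) auto
  moreover have "card (K \<union> partners n t S F) = card K + card (partners n t S F)"
    using K finite_partners by (intro card_Un_disjoint) (auto intro: finite_subset)
  ultimately show ?thesis
    by (simp add: total_def)
qed

text \<open>A smaller \<open>C\<close> could be enlarged to an \<open>r\<close>-set, which keeps all
  partners and, by \<open>exists_separating\<close>, gains a new one.\<close>

lemma optimal_singleton_card:
  assumes "optimal {C}"
  shows "card C = r"
proof (rule ccontr)
  assume ne: "card C \<noteq> r"
  have C: "C \<in> layers n R"
    using assms by (auto simp: optimal_def feasible_def)
  have "\<exists>D. C \<subseteq> D \<and> D \<subseteq> {1..n} \<and> card D = r"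
    using C layers_card[OF C] r_less by (intro exists_subset_between) (auto simp only: mem_layers_iff card_atLeastAtMost finite_atLeastAtMost)
  then obtain D where D: "C \<subseteq> D" "D \<subseteq> {1..n}" "card D = r"
    by auto
  have Dl: "D \<in> layers n R"
    using D r_in by (auto simp only: mem_layers_iff)
  have "\<not> D \<subseteq> C"
    using D ne by auto
  then obtain B where B: "B \<in> layers n S" "t \<le> card (D \<inter> B)" "card (C \<inter> B) < t"
    using exists_separating[OF D(2) _ layers_subset[OF C]] layers_card[OF Dl] layers_card[OF C] by blast
  have "t \<le> card (D \<inter> A)" if "t \<le> card (C \<inter> A)" for A
    using that card_mono[of "D \<inter> A" "C \<inter> A"] D layers_finite[OF Dl] by fastforce
  then have "partners n t S {C} \<subseteq> partners n t S {D}"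
    by (auto simp: partners_def)
  moreover have "B \<in> partners n t S {D} - partners n t S {C}"
    using B by (simp add: partners_def)
  ultimately have "partners n t S {C} \<subset> partners n t S {D}"
    by blast
  then have "card (partners n t S {C}) < card (partners n t S {D})"
    by (intro psubset_card_mono finite_partners)
  then have "total {C} < total {D}"
    by (simp add: total_def)
  then show False
    using assms feasible_singleton[OF Dl] by (auto simp: optimal_def)
qed

lemma optimal_singleton_total: "optimal {C} \<Longrightarrow> total {C} = bound_term n t r S"
  using card_partners_singleton[of C n S t] optimal_singleton_card[of C] finite_S
  by (auto simp: total_def optimal_def feasible_def mem_layers_iff)

lemma ex_optimal_singleton:
  assumes "optimal F" "light F"
  shows "\<exists>C. optimal {C}"
proof -
  obtain G where G: "optimal G" "light G"
    and min: "\<And>H. optimal H \<Longrightarrow> light H \<Longrightarrow> card G \<le> card H"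
    using ex_has_least_nat[of "\<lambda>F. optimal F \<and> light F" F card] assms by auto
  have feas: "feasible G" and fin: "finite G" and sub: "G \<subseteq> layers n R"
    using G feasible_finite by (auto simp: optimal_def feasible_def)
  obtain C where C: "C \<in> G"
    using feas by (auto simp: feasible_def)
  \<comment> \<open>The intersection with the image is optimal and light, so by minimality it is all
    of \<open>G\<close>.\<close>
  have unsep: "interchangeable G x y"
    if "A \<in> G" "x \<in> {1..n}" "y \<in> {1..n}" "x \<in> A \<longleftrightarrow> y \<in> A" for A x y
  proof -
    let ?H = "G \<inter> (`) (transpose x y) ` G"
    have "?H \<noteq> {}"
      using unseparated_in_Int_image[OF that(1,4)] by auto
    then have "card G \<le> card ?H"
      using optimal_Int_image_transpose[OF G that(2,3)] min by blast
    then have "?H = G"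
      using fin by (intro card_seteq) auto
    then show ?thesis
      by (intro interchangeable_if_subset_image) auto
  qed
  \<comment> \<open>Any other member would make all points interchangeable, contrary to
    \<open>not_all_interchangeable\<close>.\<close>
  have "D = C \<or> D = {1..n} - C" if "D \<in> G" for D
  proof (rule ccontr)
    assume ne: "\<not> (D = C \<or> D = {1..n} - C)"
    have "interchangeable G x y" if "x \<in> {1..n}" "y \<in> {1..n}" for x y
      by (rule all_interchangeable[OF sub C \<open>D \<in> G\<close>]) (use ne that unsep in blast)+
    then show False
      using not_all_interchangeable[of G] feas unfolding feasible_def by blast
  qed
  then have "G \<subseteq> {C, {1..n} - C}"
    by auto
  then consider "G = {C}" | "G = {C, {1..n} - C}"
    using C by auto
  then show ?thesis
  proof cases
    case 1
    then show ?thesis using G by auto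
  next
    case 2
    \<comment> \<open>Dropping the complement costs one member and gains at least one partner, so
      \<open>{C}\<close> is optimal as well.\<close>
    let ?C' = "{1..n} - C"
    have l: "C \<in> layers n R" "?C' \<in> layers n R"
      using 2 sub by auto
    have "\<not> C \<subseteq> ?C'"
      using layers_nonempty[OF l(1)] by auto
    then obtain B where "B \<in> layers n S" "t \<le> card (C \<inter> B)" "card (?C' \<inter> B) < t"
      using exists_separating[of C ?C'] layers_card[OF l(1)] layers_card[OF l(2)] layers_subset[OF l(1)]
      by blast
    then have "B \<in> partners n t S {C} - partners n t S {C, ?C'}"
      by (auto simp: partners_def)
    then have "partners n t S G \<subset> partners n t S {C}"
      using 2 partners_antimono[of "{C}" G n t S] by blast
    then have "card (partners n t S G) < card (partners n t S {C})"
      by (intro psubset_card_mono finite_partners)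
    then have "total G \<le> total {C}"
      using 2 card_insert_le_m1[of 2 "{?C'}" C] by (simp add: total_def card_insert_if)
    then show ?thesis
      using G feasible_singleton[OF l(1)] by (force simp: optimal_def)
  qed
qed

lemma optimal_light_total:
  assumes "optimal F" "light F"
  shows "total F = bound_term n t r S"
proof -
  obtain C where "optimal {C}"
    using ex_optimal_singleton assms by blast
  then have "total {C} = bound_term n t r S" "total F = total {C}"
    using optimal_singleton_total assms by (auto simp: optimal_def intro: antisym)
  then show ?thesis by simp
qed

lemma subset_partners_partners:
  "F \<subseteq> layers n R \<Longrightarrow> F \<subseteq> partners n t R (partners n t S F)"
  by (auto simp: partners_def Int_commute)

lemma ex_optimal:
  assumes "feasible F"
  shows "\<exists>G. optimal G"
proof -
  have "total G \<le> card (layers n R) + card (layers n S)" if "feasible G" for G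
    unfolding total_def using that
    by (intro add_mono card_mono finite_layers) (auto simp: feasible_def partners_def)
  then have "\<forall>G. feasible G \<longrightarrow> total G < Suc (card (layers n R) + card (layers n S))"
    by (simp add: less_Suc_eq_le)
  then have "\<exists>G. feasible G \<and> (\<forall>H. feasible H \<longrightarrow> total H \<le> total G)"
    by (rule ex_has_greatest_nat[where P = feasible, OF assms])
  then show ?thesis
    by (simp add: optimal_def)
qed

end

section \<open>Exchanging the roles of the two families\<close>

context layer_pair
begin

interpretation sw: layer_pair n t s r S R
  by (rule swap)

text \<open>\<open>partners\<close> is a Galois connection, so replacing a family by its partners
  never lowers the total. At an optimum nothing can be gained, hence the partners of the partners of
  \<open>F\<close> are \<open>F\<close> again.\<close>

lemma optimal_swap:
  assumes F: "optimal F"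
  shows "sw.optimal (partners n t S F)" "partners n t R (partners n t S F) = F"
    "sw.total (partners n t S F) = total F"
proof -
  let ?P = "partners n t S F"
  have sub: "F \<subseteq> layers n R" "F \<noteq> {}" "?P \<noteq> {}" "?P \<subseteq> layers n S"
    using F by (auto simp: optimal_def feasible_def partners_def)
  have FP: "F \<subseteq> partners n t R ?P"
    using subset_partners_partners sub by simp
  have le: "sw.total G \<le> total F" if G: "sw.feasible G" for G
  proof -
    let ?Q = "partners n t R G"
    have GQ: "G \<subseteq> partners n t S ?Q"
      using G sw.subset_partners_partners by (auto simp: sw.feasible_def)
    moreover have "?Q \<subseteq> layers n R"
      by (auto simp: partners_def)
    ultimately have "feasible ?Q"
      using G by (auto simp: sw.feasible_def feasible_def)
    moreover have "sw.total G \<le> total ?Q"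
      using card_mono[OF finite_partners GQ] by (simp add: sw.total_def total_def)
    ultimately show ?thesis
      using F by (force simp: optimal_def)
  qed
  have feas: "sw.feasible ?P"
    using FP sub by (auto simp: sw.feasible_def)
  have ge: "card F \<le> card (partners n t R ?P)"
    using FP finite_partners by (rule card_mono[rotated])
  then have eq: "sw.total ?P = total F"
    using le[OF feas] by (simp add: sw.total_def total_def)
  then show "sw.total ?P = total F" .
  show "sw.optimal ?P"
    using le feas eq by (simp add: sw.optimal_def)
  have "card (partners n t R ?P) = card F"
    using eq by (simp add: sw.total_def total_def)
  then show "partners n t R ?P = F"
    using FP finite_partners by (metis card_subset_eq)
qed

text \<open>Either \<open>F\<close> or its partner family is light, and each case gives one of the
  two terms.\<close>

lemma optimal_total_le:
  assumes "optimal F"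
  shows "total F \<le> max (bound_term n t r S) (bound_term n t s R)"
proof (cases "light F")
  case True
  then show ?thesis using optimal_light_total assms by simp
next
  case False
  then have "sw.light (partners n t S F)"
    using optimal_swap[OF assms] by (simp add: light_def sw.light_def)
  then show ?thesis
    using sw.optimal_light_total optimal_swap[OF assms] by simp
qed

lemma cross_intersecting_partners:
  assumes "F \<subseteq> layers n R" "G \<subseteq> layers n S" "nonempty_cross_intersecting t F G"
  shows "feasible F" "G \<subseteq> partners n t S F"
  using assms by (auto simp: feasible_def nonempty_cross_intersecting_def partners_def)

lemma cross_intersecting_bound:
  assumes "F \<subseteq> layers n R" "G \<subseteq> layers n S" "nonempty_cross_intersecting t F G"
  shows "card F + card G \<le> max (bound_term n t r S) (bound_term n t s R)"
proof -
  note F = cross_intersecting_partners[OF assms]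
  obtain H where H: "optimal H"
    using ex_optimal F by blast
  have "card F + card G \<le> total F"
    using card_mono[OF finite_partners F(2)] by (simp add: total_def)
  also have "\<dots> \<le> total H"
    using F H by (simp add: optimal_def)
  finally show ?thesis
    using optimal_total_le[OF H] by linarith
qed

text \<open>The sum is at most \<open>total F\<close>, which is at most the bound. Equality
  collapses this chain.\<close>

lemma cross_intersecting_equality:
  assumes "F \<subseteq> layers n R" "G \<subseteq> layers n S" "nonempty_cross_intersecting t F G"
    and eq: "card F + card G = max (bound_term n t r S) (bound_term n t s R)"
  shows "optimal F" "G = partners n t S F"
    "total F = max (bound_term n t r S) (bound_term n t s R)"
proof -
  note F = cross_intersecting_partners[OF assms(1-3)]
  have max: "total H \<le> card F + card G" if H: "feasible H" for H
  proof -
    obtain H' where "optimal H'"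
      using ex_optimal[OF H] by blast
    then show ?thesis
      using H eq optimal_total_le[of H'] by (auto simp: optimal_def intro: order_trans)
  qed
  have "card F + card G \<le> total F"
    using card_mono[OF finite_partners F(2)] by (simp add: total_def)
  then have tot: "total F = card F + card G"
    using max F by (simp add: antisym)
  then show "G = partners n t S F"
    using F(2) finite_partners by (simp add: total_def card_subset_eq)
  show "optimal F"
    using max tot F by (simp add: optimal_def)
  show "total F = max (bound_term n t r S) (bound_term n t s R)"
    using tot eq by simp
qed

end

section \<open>Minimal optimal families with at least two members\<close>

text \<open>The alternative in \<open>r_large\<close> reflects the two uses: \<open>t < r\<close> is
  available when \<open>R = S\<close>, and a large \<open>n\<close> when
  \<open>R \<noteq> S\<close>.\<close>

locale minimal_optimal = layer_pair +
  fixes F :: "nat set set"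
  assumes t_less_s: "t < s" and r_half: "2 * r < n" and s_half: "2 * s < n"
    and r_large: "t < r \<or> 2 * r + 2 < n"
    and opt: "optimal F" "light F" and card_F: "2 \<le> card F"
    and minimal: "\<And>G. optimal G \<Longrightarrow> light G \<Longrightarrow> 2 \<le> card G \<Longrightarrow> card F \<le> card G"
begin

lemma F_subset: "F \<subseteq> layers n R" and F_finite: "finite F" and F_partners: "partners n t S F \<noteq> {}"
  using opt feasible_finite by (auto simp: optimal_def feasible_def)

lemma F_layer: "C \<in> F \<Longrightarrow> C \<in> layers n R"
  using F_subset by blast

lemma F_mem_subset: "C \<in> F \<Longrightarrow> C \<subseteq> {1..n}" and F_mem_finite: "C \<in> F \<Longrightarrow> finite C"
  and F_mem_nonempty: "C \<in> F \<Longrightarrow> C \<noteq> {}" and F_mem_card: "C \<in> F \<Longrightarrow> t \<le> card C \<and> card C \<le> r"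
  using F_layer layers_subset layers_finite layers_nonempty layers_card by blast+

text \<open>The intersection of \<open>F\<close> with its image is optimal and light, and contains
  every member that does not separate \<open>x\<close> and \<open>y\<close>. It is a proper
  subfamily, so minimality leaves it just one member, whose size is \<open>r\<close> by
  \<open>optimal_singleton_card\<close>.\<close>

lemma unseparated_unique:
  assumes C: "C \<in> F" "x \<in> C \<longleftrightarrow> y \<in> C" and xy: "x \<in> {1..n}" "y \<in> {1..n}"
    and not_int: "\<not> interchangeable F x y"
  shows "card C = r" and "D \<in> F \<Longrightarrow> x \<in> D \<longleftrightarrow> y \<in> D \<Longrightarrow> D = C"
proof -
  let ?H = "F \<inter> (`) (transpose x y) ` F"
  have C_H: "C \<in> ?H"
    by (rule unseparated_in_Int_image[OF C])
  then have H: "optimal ?H" "light ?H"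
    using optimal_Int_image_transpose[OF opt xy] by blast+
  have "card ?H < 2"
  proof (rule ccontr)
    assume "\<not> card ?H < 2"
    then have "card F \<le> card ?H"
      using minimal[OF H] by simp
    then have "?H = F"
      using F_finite by (intro card_seteq) auto
    then show False
      using not_int interchangeable_if_subset_image[of F x y] by blast
  qed
  moreover have "finite ?H" "?H \<noteq> {}"
    using F_finite C_H by blast+
  ultimately have "card ?H = 1"
    by (metis One_nat_def card_0_eq less_2_cases)
  then have H_eq: "?H = {C}"
    using C_H by (metis card_1_singletonE singletonD)
  then show "card C = r"
    using H(1) optimal_singleton_card by simp
  show "D = C" if "D \<in> F" "x \<in> D \<longleftrightarrow> y \<in> D"
    using unseparated_in_Int_image[OF that] H_eq by blast
qed

lemma obtain_two:
  obtains C D where "C \<in> F" "D \<in> F" "C \<noteq> D"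
proof -
  have "\<not> card F \<le> 1"
    using card_F by simp
  then show thesis
    using that F_finite by (metis card_le_Suc0_iff_eq One_nat_def)
qed

text \<open>Otherwise \<open>all_interchangeable\<close> would apply to two members, which are not
  complementary as their sizes sum to at most \<open>2 * r < n\<close>.\<close>

lemma ex_unseparated:
  "\<exists>C\<in>F. \<exists>x\<in>{1..n}. \<exists>y\<in>{1..n}. (x \<in> C \<longleftrightarrow> y \<in> C) \<and> \<not> interchangeable F x y"
proof (rule ccontr)
  assume not: "\<not> ?thesis"
  obtain C D where CD: "C \<in> F" "D \<in> F" "C \<noteq> D"
    by (rule obtain_two)
  have "card ({1..n} - C) = n - card C"
    using F_mem_subset[OF CD(1)] F_mem_finite[OF CD(1)] by (simp add: card_Diff_subset)
  then have "D \<noteq> {1..n} - C"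
    using F_mem_card[OF CD(1)] F_mem_card[OF CD(2)] r_half by auto
  moreover have "interchangeable F x y"
    if "A \<in> F" "x \<in> {1..n}" "y \<in> {1..n}" "x \<in> A \<longleftrightarrow> y \<in> A" for A x y
    using not that by blast
  ultimately have "interchangeable F x y" if "x \<in> {1..n}" "y \<in> {1..n}" for x y
    using all_interchangeable[OF F_subset CD(1,2) CD(3)[symmetric] _ _ that] by blast
  then show False
    using not_all_interchangeable[OF F_subset _ F_partners] CD(1) by blast
qed

text \<open>Take a \<open>t\<close>-set \<open>T\<close> in \<open>C\<close> with a point outside
  \<open>D\<close> and fill it up by \<open>s - t\<close> points outside \<open>D\<close>: such a
  partner of \<open>C\<close> is lost once \<open>D\<close> is a member. Fewer than three lost
  partners can be found only for one choice of parameters, which \<open>card_F_gt_3\<close> treats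
  separately.\<close>

lemma card_killed_ge:
  assumes C: "C \<in> F" and D: "D \<in> F" and "\<not> C \<subseteq> D"
  shows "\<exists>K. K \<subseteq> partners n t S {C} \<and> (\<forall>B\<in>K. card (D \<inter> B) < t) \<and> finite K \<and> 2 \<le> card K
    \<and> (3 \<le> card K \<or> t = 1 \<and> s = 2 \<and> r = 2 \<and> n = 5 \<and> card D = 2)"
proof -
  obtain c where c: "c \<in> C" "c \<notin> D"
    using assms by auto
  note fin = F_mem_finite[OF C] F_mem_finite[OF D] and sub = F_mem_subset[OF C] F_mem_subset[OF D]
  have "\<exists>T. {c} \<subseteq> T \<and> T \<subseteq> C \<and> card T = t"
    using c fin t_pos F_mem_card[OF C] by (intro exists_subset_between) auto
  then obtain T where T: "c \<in> T" "T \<subseteq> C" "card T = t"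
    by auto
  have finT: "finite T"
    using T fin finite_subset by blast
  define W where "W = {1..n} - (T \<union> D)"
  have finW: "finite W"
    by (simp add: W_def)
  have "card W = n - card (T \<union> D)"
    using finT fin T sub by (simp add: W_def card_Diff_subset)
  moreover have "card (T \<union> D) + card (T \<inter> D) = t + card D"
    using card_Un_Int[OF finT fin(2)] T by simp
  moreover have "card (T \<union> D) \<le> n"
    using card_mono[of "{1..n}" "T \<union> D"] T sub by auto
  ultimately have cardW: "card W + t + card D = n + card (T \<inter> D)"
    by linarith
  then have W_ge: "s - t + 1 + card (T \<inter> D) \<le> card W"
    using F_mem_card[OF D] r_half s_half by linarith
  have TD: "card (D \<inter> T) < t"
    using T c psubset_card_mono[of T "D \<inter> T"] finT by auto
  have in_partners: "T \<union> E \<in> partners n t S {C}" if E: "E \<subseteq> {1..n} - T" "card E = s - t" for E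
  proof -
    have "finite E"
      using E finite_subset by auto
    then have "card (T \<union> E) = card T + card E"
      using E finT by (intro card_Un_disjoint) auto
    then have "card (T \<union> E) = s"
      using E T t_less_s by simp
    moreover have "T \<subseteq> C \<inter> (T \<union> E)"
      using T by blast
    then have "t \<le> card (C \<inter> (T \<union> E))"
      using T fin card_mono[of "C \<inter> (T \<union> E)" T] by simp
    moreover have "T \<union> E \<subseteq> {1..n}"
      using T E sub by blast
    ultimately show ?thesis
      using s_in by (simp add: partners_def mem_layers_iff)
  qed
  define K where "K = (\<union>) T ` {E. E \<subseteq> W \<and> card E = s - t}"
  have finK: "finite K"
    using finW by (simp add: K_def)
  have K_sub: "K \<subseteq> partners n t S {C}"
    using in_partners by (auto simp: K_def W_def)
  have K_D: "D \<inter> B = D \<inter> T" if "B \<in> K" for B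
    using that by (auto simp: K_def W_def)
  have "inj_on ((\<union>) T) {E. E \<subseteq> W \<and> card E = s - t}"
    by (rule inj_onI) (auto simp: W_def)
  then have "card K = card W choose (s - t)"
    using finW by (simp add: K_def card_image n_subsets)
  then have cardK: "card W \<le> card K"
    using W_ge t_less_s by (simp add: binomial_ge_top)
  show ?thesis
  proof (cases "3 \<le> card K")
    case True
    then show ?thesis
      using K_sub K_D TD finK by (intro exI[of _ K]) auto
  next
    case False
    \<comment> \<open>With fewer than three such sets the estimates \<open>W_ge\<close> and
      \<open>cardK\<close> are tight.\<close>
    then have small: "card W = 2" "s = t + 1" "card (T \<inter> D) = 0"
      using W_ge cardK t_less_s by linarith+
    then have TD0: "T \<inter> D = {}"
      using finT by simp
    show ?thesis
    proof (cases "t = 1")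
      case True
      have "t = 1 \<and> s = 2 \<and> r = 2 \<and> n = 5 \<and> card D = 2"
        using True small cardW F_mem_card[OF D] r_half s_half by linarith
      then show ?thesis
        using K_sub K_D TD finK cardK small by (intro exI[of _ K]) auto
    next
      case t: False
      \<comment> \<open>As \<open>t\<close> is at least 2, a third lost partner may touch
        \<open>D\<close> in one point.\<close>
      obtain d where d: "d \<in> D"
        using F_mem_nonempty[OF D] by blast
      let ?B = "T \<union> {d}"
      have "?B \<in> partners n t S {C}"
        using d small TD0 sub by (intro in_partners) auto
      moreover have DB: "D \<inter> ?B = {d}"
        using d TD0 by auto
      moreover have "?B \<notin> K"
        using DB K_D[of ?B] TD0 by auto
      ultimately show ?thesis
        using K_sub K_D TD finK cardK small t t_pos by (intro exI[of _ "insert ?B K"]) auto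
    qed
  qed
qed

text \<open>At most three members allow at most two lost partners, which forces the exceptional
  parameters: three 2-sets in \<open>[5]\<close> with \<open>t = 1\<close> and \<open>s = 2\<close>.
  There one further lost partner refutes optimality.\<close>

lemma card_F_gt_3: "3 < card F"
proof (rule ccontr)
  assume "\<not> 3 < card F"
  then have le3: "card F \<le> 3"
    by simp
  have exceptional: "t = 1 \<and> s = 2 \<and> r = 2 \<and> n = 5 \<and> card D = 2 \<and> card F = 3"
    if CD: "C \<in> F" "D \<in> F" "\<not> C \<subseteq> D" for C D
  proof -
    obtain K where K: "K \<subseteq> partners n t S {C}" "\<forall>B\<in>K. card (D \<inter> B) < t" "2 \<le> card K"
      "3 \<le> card K \<or> t = 1 \<and> s = 2 \<and> r = 2 \<and> n = 5 \<and> card D = 2"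
      using card_killed_ge[OF CD] by blast
    have "K \<inter> partners n t S F = {}"
      using K(2) CD(2) by (force simp: partners_def)
    then have "card K < card F"
      using card_killed_less[OF opt(1) CD(1) K(1)] by blast
    then show ?thesis
      using K le3 by linarith
  qed
  have card2: "card C = 2" and incomparable: "\<not> C \<subseteq> D" if CD: "C \<in> F" "D \<in> F" "C \<noteq> D" for C D
  proof -
    have *: "\<not> A \<subseteq> B" if A: "A \<in> F" "B \<in> F" "A \<noteq> B" for A B
    proof
      assume AB: "A \<subseteq> B"
      then have "\<not> B \<subseteq> A"
        using A by auto
      then have "card A = 2" "card B \<le> 2"
        using exceptional[OF A(2,1)] F_mem_card[OF A(2)] by auto
      then show False
        using AB A card_seteq[OF F_mem_finite[OF A(2)] AB] by simp
    qed
    show "\<not> C \<subseteq> D" "card C = 2"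
      using *[of C D] *[of D C] exceptional[of D C] CD by auto
  qed
  obtain C D where CD: "C \<in> F" "D \<in> F" "C \<noteq> D"
    by (rule obtain_two)
  note exc = exceptional[OF CD(1,2) incomparable[OF CD]]
  have "\<not> F \<subseteq> {C, D}"
    using exc card_mono[of "{C, D}" F] CD by auto
  then obtain E where E: "E \<in> F" "E \<noteq> C" "E \<noteq> D"
    by blast
  obtain c where c: "c \<in> C" "c \<notin> E"
    using incomparable[OF CD(1) E(1)] E by blast
  obtain d where d: "d \<in> D" "d \<notin> E"
    using incomparable[OF CD(2) E(1)] E by blast
  have "card ({1..n} - E - {c, d}) \<ge> 1"
  proof -
    have "card ({1..n} - E) = 3"
      using card2[OF E(1) CD(1)] E exc F_mem_subset[OF E(1)] F_mem_finite[OF E(1)]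
      by (simp add: card_Diff_subset)
    moreover have "card {c, d} \<le> 2"
      by (simp add: card_insert_if)
    ultimately show ?thesis
      using diff_card_le_card_Diff[of "{c, d}" "{1..n} - E"] by simp
  qed
  then have "{1..n} - E - {c, d} \<noteq> {}"
    by (metis card.empty not_one_le_zero)
  then obtain x where x: "x \<in> {1..n}" "x \<notin> E" "x \<noteq> c" "x \<noteq> d"
    by blast
  define B where "B = (if c = d then {c, x} else {c, d})"
  have "c \<in> {1..n}" "d \<in> {1..n}"
    using c d F_mem_subset CD by blast+
  then have "B \<subseteq> {1..n}" "card B = 2"
    using x by (auto simp: B_def)
  then have B: "B \<in> layers n S"
    using exc s_in by (simp add: mem_layers_iff)
  have "E \<inter> B = {}" "c \<in> C \<inter> B" "d \<in> D \<inter> B"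
    using c d x by (auto simp: B_def)
  then have hit: "card (E \<inter> B) = 0" "1 \<le> card (C \<inter> B)" "1 \<le> card (D \<inter> B)"
    using F_mem_finite CD by (auto simp: Suc_le_eq card_gt_0_iff)
  obtain K where K: "K \<subseteq> partners n t S {C}" "\<forall>B\<in>K. card (D \<inter> B) < t" "2 \<le> card K" "finite K"
    using card_killed_ge[OF CD(1,2) incomparable[OF CD]] by blast
  have "B \<notin> K"
    using K(2) hit exc by force
  then have "3 \<le> card (insert B K)"
    using K by simp
  moreover have "insert B K \<subseteq> partners n t S {C}"
    using B hit exc K by (simp add: partners_def)
  moreover have "insert B K \<inter> partners n t S F = {}"
    using K(2) CD(2) E(1) hit exc by (force simp: partners_def)
  ultimately have "3 \<le> card (insert B K)" "card (insert B K) < card F"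
    using card_killed_less[OF opt(1) CD(1)] by blast+
  then show False
    using exc by simp
qed

section \<open>The two classes of interchangeable points\<close>

definition classes :: "nat set \<Rightarrow> nat set \<Rightarrow> bool" where
  "classes P Q \<longleftrightarrow> P \<union> Q = {1..n} \<and> P \<inter> Q = {} \<and> P \<noteq> {} \<and> Q \<noteq> {} \<and>
    (\<forall>a\<in>P. \<forall>b\<in>P. interchangeable F a b) \<and> (\<forall>a\<in>Q. \<forall>b\<in>Q. interchangeable F a b) \<and>
    (\<forall>a\<in>P. \<forall>b\<in>Q. \<not> interchangeable F a b)"

lemma classes_swap: "classes P Q \<Longrightarrow> classes Q P"
  unfolding classes_def using interchangeable_sym by (simp add: Un_commute Int_commute) blast

lemma exchange: "C \<in> F \<Longrightarrow> interchangeable F a b \<Longrightarrow> a \<in> C \<Longrightarrow> b \<notin> C \<Longrightarrow> insert b (C - {a}) \<in> F"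
  by (metis image_transpose_member interchangeable_def)

text \<open>If all pairs across the classes are separated, \<open>D\<close> contains one class and
  misses the other.\<close>

lemma separating_eq_class:
  assumes PQ: "classes P Q" and D: "D \<in> F" and sep: "\<And>x y. x \<in> P \<Longrightarrow> y \<in> Q \<Longrightarrow> x \<in> D \<longleftrightarrow> y \<notin> D"
  shows "D = P \<or> D = Q"
proof -
  obtain x y where "x \<in> P" "y \<in> Q"
    using PQ by (auto simp: classes_def)
  then have "(P \<subseteq> D \<and> Q \<inter> D = {}) \<or> (P \<inter> D = {} \<and> Q \<subseteq> D)"
    using sep by blast
  then show ?thesis
    using PQ F_mem_subset[OF D] by (auto simp: classes_def)
qed

text \<open>Every member leaves one of the three pairs unseparated, and every pair is left
  unseparated by at most one member, which gives at most three members.\<close>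

lemma not_three_classes:
  assumes x: "x \<in> {1..n}" and y: "y \<in> {1..n}" and z: "z \<in> {1..n}"
    and ni: "\<not> interchangeable F x y" "\<not> interchangeable F x z" "\<not> interchangeable F y z"
  shows False
proof -
  let ?N = "\<lambda>a b. {D \<in> F. a \<in> D \<longleftrightarrow> b \<in> D}"
  have le1: "card (?N a b) \<le> 1" if "a \<in> {1..n}" "b \<in> {1..n}" "\<not> interchangeable F a b" for a b
    using unseparated_unique(2)[OF _ _ that] F_finite
    by (auto simp: card_le_Suc0_iff_eq)
  have "F \<subseteq> ?N x y \<union> ?N x z \<union> ?N y z"
    by auto
  then have "card F \<le> card (?N x y \<union> ?N x z \<union> ?N y z)"
    using F_finite by (intro card_mono) auto
  also have "\<dots> \<le> card (?N x y) + card (?N x z) + card (?N y z)"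
    using card_Un_le[of "?N x y \<union> ?N x z" "?N y z"] card_Un_le[of "?N x y" "?N x z"] by linarith
  also have "\<dots> \<le> 3"
    using le1[OF x y ni(1)] le1[OF x z ni(2)] le1[OF y z ni(3)] by linarith
  finally show False
    using card_F_gt_3 by simp
qed

text \<open>By \<open>not_three_classes\<close> every point is interchangeable with \<open>x\<close>
  or with \<open>y\<close>.\<close>

lemma classes_of:
  assumes x: "x \<in> {1..n}" and y: "y \<in> {1..n}" and ni: "\<not> interchangeable F x y"
  shows "classes {z \<in> {1..n}. interchangeable F z x} {z \<in> {1..n}. interchangeable F z y}"
proof -
  let ?P = "{z \<in> {1..n}. interchangeable F z x}" and ?Q = "{z \<in> {1..n}. interchangeable F z y}"
  have "interchangeable F z x \<or> interchangeable F z y" if "z \<in> {1..n}" for z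
    using not_three_classes[OF x y that ni] interchangeable_sym by blast
  then have cover: "?P \<union> ?Q = {1..n}"
    by blast
  have sep: "\<not> interchangeable F a b" if "interchangeable F a x" "interchangeable F b y" for a b
    using that ni interchangeable_sym interchangeable_trans by blast
  have same: "interchangeable F a b" if "interchangeable F a c" "interchangeable F b c" for a b c
    using that interchangeable_sym interchangeable_trans by blast
  have disjoint: "?P \<inter> ?Q = {}"
    using sep interchangeable_refl by blast
  have nonempty: "x \<in> ?P" "y \<in> ?Q"
    using x y interchangeable_refl by simp_all
  show ?thesis
    unfolding classes_def
  proof (intro conjI ballI cover disjoint)
    show "?P \<noteq> {}" "?Q \<noteq> {}"
      using nonempty by blast+
  next
    fix a b assume "a \<in> ?P" "b \<in> ?P"
    then show "interchangeable F a b"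
      using same[of a x b] by simp
  next
    fix a b assume "a \<in> ?Q" "b \<in> ?Q"
    then show "interchangeable F a b"
      using same[of a y b] by simp
  next
    fix a b assume "a \<in> ?P" "b \<in> ?Q"
    then show "\<not> interchangeable F a b"
      using sep[of a b] by simp
  qed
qed

text \<open>Uniqueness of unseparated members forces \<open>C = Q - {y}\<close>, and then every
  member is \<open>P\<close> or of the form \<open>Q - {z}\<close>. So \<open>F\<close> has at most
  \<open>r + 2\<close> members, while at least that many partners are lost, contrary to
  \<open>card_killed_less\<close>.\<close>

lemma not_avoiding_class:
  assumes PQ: "classes P Q" and C: "C \<in> F" "C \<inter> P = {}" and y: "y \<in> Q" "y \<notin> C"
  shows False
proof -
  have sub: "P \<subseteq> {1..n}" "Q \<subseteq> {1..n}"
    using PQ by (auto simp only: classes_def)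
  have finQ: "finite Q"
    using sub finite_subset by blast
  obtain x where x: "x \<in> P"
    using PQ by (auto simp: classes_def)
  have ni: "\<not> interchangeable F a b" if "a \<in> P" "b \<in> Q" for a b
    using that PQ by (simp add: classes_def)
  have uniq: "D = E" if "D \<in> F" "a \<in> D \<longleftrightarrow> b \<in> D" "E \<in> F" "a \<in> E \<longleftrightarrow> b \<in> E" "a \<in> P" "b \<in> Q" for D E a b
    using that sub unseparated_unique(2)[OF that(3,4) _ _ ni[OF that(5,6)] that(1,2)] by blast
  have xy: "x \<in> {1..n}" "y \<in> {1..n}" "x \<in> C \<longleftrightarrow> y \<in> C"
    using x y sub C by blast+
  have cardC: "card C = r"
    by (rule unseparated_unique(1)[OF C(1) xy(3,1,2) ni[OF x y(1)]])
  have C_Q: "C \<subseteq> Q"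
    using C PQ F_mem_subset[OF C(1)] by (auto simp: classes_def)
  have intQ: "interchangeable F a b" if "a \<in> Q" "b \<in> Q" for a b
    using that PQ by (simp add: classes_def)
  \<comment> \<open>A second missing point \<open>z\<close> of \<open>Q\<close> could be exchanged
    for a point of \<open>C\<close>, giving another member that contains neither \<open>x\<close>
    nor \<open>y\<close>.\<close>
  have C_eq: "C = Q - {y}"
  proof (rule ccontr)
    assume "C \<noteq> Q - {y}"
    then obtain z where z: "z \<in> Q" "z \<notin> C" "z \<noteq> y"
      using C_Q y by blast
    obtain c where c: "c \<in> C"
      using F_mem_nonempty[OF C(1)] by blast
    have D: "insert z (C - {c}) \<in> F"
      using exchange[OF C(1) intQ c z(2)] c C_Q z by blast
    have "x \<notin> insert z (C - {c})"
      using x C(2) z PQ by (auto simp: classes_def)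
    then have "insert z (C - {c}) = C"
      using uniq[OF D _ C(1) xy(3) x y(1)] y z by blast
    then show False
      using z by blast
  qed
  have cardQ: "card Q = r + 1"
    using cardC C_eq y finQ by (simp add: card_Diff_singleton) (metis Suc_pred card_gt_0_iff empty_iff)
  have mem: "Q - {z} \<in> F" if z: "z \<in> Q" for z
  proof (cases "z = y")
    case False
    then have "insert y (C - {z}) \<in> F"
      using z y C_eq exchange[OF C(1) intQ[OF z y(1)]] by blast
    moreover have "insert y (C - {z}) = Q - {z}"
      using C_eq y z False by blast
    ultimately show ?thesis by simp
  qed (use C C_eq in simp)
  have "D \<in> insert P ((\<lambda>z. Q - {z}) ` Q)" if D: "D \<in> F" for D
  proof (cases "\<exists>a\<in>P. \<exists>b\<in>Q. a \<in> D \<longleftrightarrow> b \<in> D")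
    case True
    then obtain a b where ab: "a \<in> P" "b \<in> Q" "a \<in> D \<longleftrightarrow> b \<in> D"
      by blast
    have "a \<notin> Q"
      using ab PQ by (auto simp: classes_def)
    then have "D = Q - {b}"
      using uniq[OF D ab(3) mem[OF ab(2)] _ ab(1,2)] by blast
    then show ?thesis
      using ab by blast
  next
    case False
    then have "D = P \<or> D = Q"
      using separating_eq_class[OF PQ D] by blast
    then show ?thesis
      using F_mem_card[OF D] cardQ by auto
  qed
  then have "card F \<le> card (insert P ((\<lambda>z. Q - {z}) ` Q))"
    using finQ by (intro card_mono) auto
  also have "\<dots> \<le> Suc (card ((\<lambda>z. Q - {z}) ` Q))"
    using finQ by (simp add: card_insert_if)
  also have "\<dots> \<le> r + 2"
    using card_image_le[OF finQ, of "\<lambda>z. Q - {z}"] cardQ by simp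
  finally have F_le: "card F \<le> r + 2" .
  \<comment> \<open>These partners meet \<open>C\<close> in exactly \<open>t\<close> points and
    avoid \<open>y\<close>, so trading a common point \<open>z\<close> for \<open>y\<close> gives
    the member \<open>Q - {z}\<close>, which meets them in only \<open>t - 1\<close>.\<close>
  define K where "K = {B. B \<subseteq> {1..n} - {y} \<and> card B = s \<and> card (B \<inter> C) = t}"
  have "K \<subseteq> partners n t S {C}"
    using s_in by (auto simp: K_def partners_def mem_layers_iff Int_commute)
  moreover have "K \<inter> partners n t S F = {}"
  proof -
    have "B \<notin> partners n t S F" if B: "B \<in> K" for B
    proof -
      have "B \<inter> C \<noteq> {}"
        using B t_pos by (auto simp: K_def)
      then obtain z where z: "z \<in> B \<inter> C"
        by blast
      then have "(Q - {z}) \<inter> B = (B \<inter> C) - {z}"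
        using B C_eq by (auto simp: K_def)
      moreover have "card ((B \<inter> C) - {z}) < card (B \<inter> C)"
        using z F_mem_finite[OF C(1)] by (intro psubset_card_mono) auto
      ultimately have "card ((Q - {z}) \<inter> B) < t"
        using B by (simp add: K_def)
      moreover have "Q - {z} \<in> F"
        using z C_Q by (intro mem) blast
      ultimately show ?thesis
        by (force simp: partners_def)
    qed
    then show ?thesis by blast
  qed
  ultimately have "card K < card F"
    using card_killed_less[OF opt(1) C(1)] by blast
  moreover have "card K = (r choose t) * ((n - 1 - r) choose (s - t))"
  proof -
    have "C \<subseteq> {1..n} - {y}"
      using C_eq sub by blast
    moreover have "card ({1..n} - {y} - C) = n - 1 - r"
      using calculation cardC xy F_mem_finite[OF C(1)] by (subst card_Diff_subset) auto
    ultimately show ?thesis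
      using t_less_s cardC unfolding K_def by (subst card_subsets_meeting_in) auto
  qed
  moreover have big: "n - 1 - r \<le> (n - 1 - r) choose (s - t)"
    using t_less_s r_half s_half t_pos by (intro binomial_ge_top) linarith+
  \<comment> \<open>If \<open>t < r\<close>, both factors are at least \<open>r\<close>; if
    \<open>t = r\<close>, the first is 1 and \<open>r_large\<close> makes the second large
    enough.\<close>
  moreover have "r + 2 \<le> (r choose t) * ((n - 1 - r) choose (s - t))"
  proof (cases "t < r")
    case True
    have "r * r \<le> (r choose t) * ((n - 1 - r) choose (s - t))"
      using True t_pos big r_half by (intro mult_le_mono binomial_ge_top) linarith+
    moreover have "2 * r \<le> r * r"
      using True t_pos by simp
    ultimately show ?thesis
      using True t_pos by linarith
  next
    case False
    then have "r + 2 \<le> n - 1 - r" "r = t"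
      using r_large t_le_r by linarith+
    then show ?thesis
      using big by simp
  qed
  ultimately show False
    using F_le by linarith
qed

text \<open>Here \<open>C = insert y P\<close>, the members are the sets \<open>insert z P\<close>
  with \<open>z\<close> in \<open>Q\<close> and possibly \<open>P\<close>, and so
  \<open>card F\<close> is at most \<open>n - r + 2\<close>. Comparing with the number of lost
  partners, a product of two binomial coefficients, leaves only \<open>s = t + 1\<close> and then
  \<open>t = 1\<close>.\<close>

lemma containing_class:
  assumes PQ: "classes P Q" and C: "C \<in> F" "P \<subseteq> C" and y: "y \<in> Q" "y \<in> C"
  shows "t = 1 \<and> s = 2 \<and> 2 \<le> r \<and> P \<subseteq> {1..n} \<and> card P = r - 1 \<and> (\<forall>z\<in>{1..n} - P. insert z P \<in> F)
    \<and> (\<forall>D\<in>F. D = P \<or> (\<exists>z\<in>{1..n} - P. D = insert z P))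
    \<and> (\<forall>B\<in>partners n t S F. P \<inter> B \<noteq> {}) \<and> (1 \<in> S \<longrightarrow> P \<in> F)"
proof -
  have sub: "P \<subseteq> {1..n}" "Q = {1..n} - P"
    using PQ by (auto simp only: classes_def)
  have fin: "finite P" "finite Q"
    using sub finite_subset by auto
  obtain x where x: "x \<in> P"
    using PQ by (auto simp: classes_def)
  have ni: "\<not> interchangeable F a b" if "a \<in> P" "b \<in> Q" for a b
    using that PQ by (simp add: classes_def)
  have uniq: "D = E" if "D \<in> F" "a \<in> D \<longleftrightarrow> b \<in> D" "E \<in> F" "a \<in> E \<longleftrightarrow> b \<in> E" "a \<in> P" "b \<in> Q" for D E a b
    using that sub unseparated_unique(2)[OF that(3,4) _ _ ni[OF that(5,6)] that(1,2)] by blast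
  have xy: "x \<in> {1..n}" "y \<in> {1..n}" "x \<in> C \<longleftrightarrow> y \<in> C"
    using x y sub C by blast+
  have cardC: "card C = r"
    by (rule unseparated_unique(1)[OF C(1) xy(3,1,2) ni[OF x y(1)]])
  have intQ: "interchangeable F a b" if "a \<in> Q" "b \<in> Q" for a b
    using that PQ by (simp add: classes_def)
  have C_eq: "C = insert y P"
  proof (rule ccontr)
    assume "C \<noteq> insert y P"
    then obtain z where z: "z \<in> C" "z \<notin> P" "z \<noteq> y"
      using C y by blast
    have zQ: "z \<in> Q"
      using z F_mem_subset[OF C(1)] sub by blast
    obtain b where b: "b \<in> {1..n}" "b \<notin> C"
      using layers_proper[OF F_layer[OF C(1)]] by blast
    then have "b \<in> Q"
      using C sub by blast
    then have D: "insert b (C - {z}) \<in> F"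
      using exchange[OF C(1) intQ[OF zQ] z(1) b(2)] by blast
    have "insert b (C - {z}) = C"
      using uniq[OF D _ C(1) xy(3) x y(1)] x y z C by blast
    then show False
      using b by blast
  qed
  have yP: "y \<notin> P"
    using y sub by blast
  have cardP: "card P = r - 1" "1 \<le> r"
    using cardC C_eq yP fin by auto
  have cardQ: "card Q = n - r + 1"
    using sub fin cardP r_less by (simp add: card_Diff_subset)
  have mem: "insert z P \<in> F" if z: "z \<in> Q" for z
  proof (cases "z = y")
    case False
    then have "insert z (C - {y}) \<in> F"
      using z y C_eq sub exchange[OF C(1) intQ[OF y(1) z]] by blast
    moreover have "insert z (C - {y}) = insert z P"
      using C_eq yP by blast
    ultimately show ?thesis by simp
  qed (use C C_eq in simp)
  have all: "D = P \<or> (\<exists>z\<in>Q. D = insert z P)" if D: "D \<in> F" for D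
  proof (cases "\<exists>a\<in>P. \<exists>b\<in>Q. a \<in> D \<longleftrightarrow> b \<in> D")
    case True
    then obtain a b where ab: "a \<in> P" "b \<in> Q" "a \<in> D \<longleftrightarrow> b \<in> D"
      by blast
    have "D = insert b P"
      using uniq[OF D ab(3) mem[OF ab(2)] _ ab(1,2)] ab by blast
    then show ?thesis
      using ab by blast
  next
    case False
    then have "D = P \<or> D = Q"
      using separating_eq_class[OF PQ D] by blast
    then show ?thesis
      using F_mem_card[OF D] cardQ r_half by auto
  qed
  have card_ins: "card ((\<lambda>z. insert z P) ` Q) \<le> n - r + 1"
    using card_image_le[OF fin(2), of "\<lambda>z. insert z P"] cardQ by simp
  have F_le: "card F \<le> n - r + 2" and F_le': "P \<notin> F \<Longrightarrow> card F \<le> n - r + 1"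
  proof -
    have "card F \<le> card (insert P ((\<lambda>z. insert z P) ` Q))"
      using fin all by (intro card_mono) auto
    then show "card F \<le> n - r + 2"
      using card_ins fin by (simp add: card_insert_if split: if_splits)
    show "card F \<le> n - r + 1" if "P \<notin> F"
    proof -
      have "card F \<le> card ((\<lambda>z. insert z P) ` Q)"
        using fin all that by (intro card_mono) auto
      then show ?thesis using card_ins by simp
    qed
  qed
  \<comment> \<open>A partner meeting \<open>P\<close> in fewer than \<open>t\<close> points would
    need every \<open>z\<close> in \<open>Q\<close>, but \<open>Q\<close> has more than
    \<open>s\<close> points.\<close>
  have hit: "t \<le> card (P \<inter> B)" if B: "B \<in> partners n t S F" for B
  proof (rule ccontr)
    assume not: "\<not> t \<le> card (P \<inter> B)"
    have "Q \<subseteq> B"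
    proof
      fix z assume z: "z \<in> Q"
      then have "t \<le> card (insert z P \<inter> B)"
        using mem B by (auto simp: partners_def)
      then show "z \<in> B"
        using not by (cases "z \<in> B") auto
    qed
    moreover have "finite B" "card B \<le> s"
      using B S_range finite_subset by (auto simp: partners_def mem_layers_iff)
    ultimately have "card Q \<le> s"
      using card_mono order_trans by blast
    then show False
      using cardQ r_half s_half by linarith
  qed
  have t_r: "t + 1 \<le> r"
  proof -
    obtain B where "B \<in> partners n t S F"
      using F_partners by blast
    then have "t \<le> card P"
      using hit[of B] card_mono[of P "P \<inter> B"] fin by fastforce
    then show ?thesis
      using cardP by linarith
  qed
  \<comment> \<open>Sets through \<open>y\<close> that meet \<open>P\<close> in \<open>t - 1\<close>
    points: with \<open>y\<close> they reach \<open>t\<close> points of \<open>C\<close>, but by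
    \<open>hit\<close> they are not partners of \<open>F\<close>.\<close>
  define K where "K = insert y ` {B. B \<subseteq> {1..n} - {y} \<and> card B = s - 1 \<and> card (B \<inter> P) = t - 1}"
  have y_card: "card (insert y P \<inter> insert y B) = Suc (card (P \<inter> B))" if "B \<subseteq> {1..n} - {y}" for B
  proof -
    have "insert y P \<inter> insert y B = insert y (P \<inter> B)" by blast
    then show ?thesis using that yP fin by simp
  qed
  have K_props: "B \<subseteq> {1..n} \<and> y \<in> B \<and> card B = s \<and> card (P \<inter> B) < t \<and> t \<le> card (C \<inter> B)" if BK: "B \<in> K" for B
  proof -
    obtain B' where B': "B = insert y B'" "B' \<subseteq> {1..n} - {y}" "card B' = s - 1" "card (B' \<inter> P) = t - 1"
      using BK unfolding K_def by blast
    have "finite B'"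
      using B' finite_subset by blast
    moreover have "P \<inter> insert y B' = B' \<inter> P"
      using yP by blast
    moreover have "y \<notin> B'"
      using B' by blast
    ultimately show ?thesis
      using B' y_card[OF B'(2)] C_eq xy t_pos t_less_s by (auto simp: Int_commute)
  qed
  have K_sub: "K \<subseteq> partners n t S {C}"
    using K_props s_in by (auto simp: partners_def mem_layers_iff)
  have K_disj: "K \<inter> partners n t S F = {}"
    using K_props hit by (meson disjoint_iff not_le)
  have cardK: "card K = ((r - 1) choose (t - 1)) * ((n - r) choose (s - t))"
  proof -
    have "inj_on (insert y) {B. B \<subseteq> {1..n} - {y} \<and> card B = s - 1 \<and> card (B \<inter> P) = t - 1}"
      by (rule inj_onI) (auto simp: insert_ident)
    moreover have P_sub: "P \<subseteq> {1..n} - {y}"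
      using sub yP by blast
    moreover have "card ({1..n} - {y} - P) = n - r"
      using P_sub cardP xy fin r_less by (subst card_Diff_subset) auto
    ultimately show ?thesis
      using t_less_s t_pos cardP unfolding K_def
      by (simp add: card_image card_subsets_meeting_in)
  qed
  have cardK_less: "card K < card F"
    by (rule card_killed_less[OF opt(1) C(1) K_sub K_disj])
  \<comment> \<open>Otherwise the second factor alone exceeds \<open>n - r + 1\<close>, so
    \<open>card K\<close> reaches the upper bound on \<open>card F\<close>.\<close>
  have s_t: "s = t + 1"
  proof (rule ccontr)
    assume "s \<noteq> t + 1"
    then have "n - r + 1 < (n - r) choose (s - t)"
      using t_less_s t_pos r_half s_half by (intro binomial_gt_Suc_top) linarith+
    moreover have "1 * ((n - r) choose (s - t)) \<le> card K"
      unfolding cardK using t_r by (intro mult_le_mono1) (simp add: Suc_le_eq)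
    ultimately show False
      using cardK_less F_le by linarith
  qed
  \<comment> \<open>For \<open>t\<close> at least 2 the first factor of \<open>card K\<close> is at
    least 2, and \<open>2 * (n - r)\<close> lost partners are too many.\<close>
  have t_1: "t = 1"
  proof (rule ccontr)
    assume "t \<noteq> 1"
    then have "r - 1 \<le> (r - 1) choose (t - 1)" "2 \<le> r - 1"
      using t_r t_pos by (auto intro!: binomial_ge_top)
    then have "2 * (n - r) \<le> card K"
      unfolding cardK using s_t by simp
    then show False
      using cardK_less F_le r_half s_half t_less_s t_pos by linarith
  qed
  \<comment> \<open>Without \<open>P\<close> the bound on \<open>card F\<close> drops by one, and
    the singleton \<open>{y}\<close> is a further lost partner, outside \<open>K\<close> because of
    its size.\<close>
  have "P \<in> F" if "1 \<in> S"
  proof (rule ccontr)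
    assume "P \<notin> F"
    have yB: "{y} \<notin> K"
      using K_props s_t t_1 by fastforce
    have "C \<inter> {y} = {y}" "P \<inter> {y} = {}"
      using C_eq yP by auto
    then have "insert {y} K \<subseteq> partners n t S {C}" "insert {y} K \<inter> partners n t S F = {}"
      using K_sub K_disj hit[of "{y}"] that xy t_1 by (auto simp: partners_def mem_layers_iff)
    then have "card (insert {y} K) < card F"
      by (rule card_killed_less[OF opt(1) C(1)])
    moreover have "finite K"
      using K_sub finite_partners finite_subset by blast
    ultimately show False
      using F_le'[OF \<open>P \<notin> F\<close>] yB cardK s_t t_1 by simp
  qed
  moreover have "\<forall>B\<in>partners n t S F. P \<inter> B \<noteq> {}"
    using hit t_pos by (metis card.empty not_le)
  ultimately show ?thesis
    using t_1 s_t t_r sub cardP mem all by (intro conjI) auto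
qed

text \<open>Take a member that does not separate \<open>x\<close> and \<open>y\<close> from
  different classes. By exchanges inside the classes it must contain a whole class or avoid one;
  \<open>not_avoiding_class\<close> refutes the second case.\<close>

lemma minimal_structure:
  "t = 1 \<and> s = 2 \<and> 2 \<le> r \<and> (\<exists>P. P \<subseteq> {1..n} \<and> card P = r - 1 \<and> (\<forall>z\<in>{1..n} - P. insert z P \<in> F)
    \<and> (\<forall>D\<in>F. D = P \<or> (\<exists>z\<in>{1..n} - P. D = insert z P))
    \<and> (\<forall>B\<in>partners n t S F. P \<inter> B \<noteq> {}) \<and> (1 \<in> S \<longrightarrow> P \<in> F))"
proof -
  obtain C x y where C: "C \<in> F" and xy: "x \<in> {1..n}" "y \<in> {1..n}" and unsep: "x \<in> C \<longleftrightarrow> y \<in> C"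
    and ni: "\<not> interchangeable F x y"
    using ex_unseparated by blast
  define P where "P = {z \<in> {1..n}. interchangeable F z x}"
  define Q where "Q = {z \<in> {1..n}. interchangeable F z y}"
  have PQ: "classes P Q"
    unfolding P_def Q_def by (rule classes_of[OF xy ni])
  have QP: "classes Q P"
    by (rule classes_swap[OF PQ])
  have x: "x \<in> P" and y: "y \<in> Q"
    using xy interchangeable_refl by (auto simp: P_def Q_def)
  have disj: "x \<notin> Q" "y \<notin> P"
    using PQ x y by (auto simp: classes_def)
  have intP: "interchangeable F x a" if "a \<in> P" for a
    using that interchangeable_sym by (simp add: P_def)
  have intQ: "interchangeable F y a" if "a \<in> Q" for a
    using that interchangeable_sym by (simp add: Q_def)
  show ?thesis
  proof (cases "x \<in> C")
    case True
    \<comment> \<open>Otherwise exchanging \<open>x\<close> for \<open>a\<close> and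
      \<open>y\<close> for \<open>b\<close> gives another member that contains neither
      \<open>x\<close> nor \<open>y\<close>, against uniqueness.\<close>
    have "P \<subseteq> C \<or> Q \<subseteq> C"
    proof (rule ccontr)
      assume "\<not> ?thesis"
      then obtain a b where ab: "a \<in> P" "a \<notin> C" "b \<in> Q" "b \<notin> C"
        by blast
      have 1: "insert a (C - {x}) \<in> F"
        by (rule exchange[OF C intP[OF ab(1)] True ab(2)])
      have "insert b (insert a (C - {x}) - {y}) \<in> F"
        by (rule exchange[OF 1 intQ[OF ab(3)]])
          (use True unsep ab disj x y PQ in \<open>auto simp: classes_def\<close>)
      moreover have "x \<notin> insert b (insert a (C - {x}) - {y})" "y \<notin> insert b (insert a (C - {x}) - {y})"
        using True unsep ab by auto
      ultimately have "insert b (insert a (C - {x}) - {y}) = C"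
        using unseparated_unique(2)[OF C unsep xy ni] by blast
      then show False
        using ab by blast
    qed
    then show ?thesis
    proof
      assume "P \<subseteq> C"
      then show ?thesis
        using containing_class[OF PQ C _ y] True unsep by blast
    next
      assume "Q \<subseteq> C"
      then show ?thesis
        using containing_class[OF QP C _ x] True by blast
    qed
  next
    case False
    have "C \<inter> P = {} \<or> C \<inter> Q = {}"
    proof (rule ccontr)
      assume "\<not> ?thesis"
      then obtain a b where ab: "a \<in> P" "a \<in> C" "b \<in> Q" "b \<in> C"
        by blast
      have 1: "insert x (C - {a}) \<in> F"
        by (rule exchange[OF C interchangeable_sym[OF intP[OF ab(1)]] ab(2) False])
      have "insert y (insert x (C - {a}) - {b}) \<in> F"
        by (rule exchange[OF 1 interchangeable_sym[OF intQ[OF ab(3)]]])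
          (use False unsep ab disj x y PQ in \<open>auto simp: classes_def\<close>)
      moreover have "x \<in> insert y (insert x (C - {a}) - {b})" "y \<in> insert y (insert x (C - {a}) - {b})"
        using False ab by auto
      ultimately have "insert y (insert x (C - {a}) - {b}) = C"
        using unseparated_unique(2)[OF C unsep xy ni] by blast
      then show False
        using False unsep by blast
    qed
    then show ?thesis
      using not_avoiding_class[OF PQ C _ y] not_avoiding_class[OF QP C _ x] False unsep by blast
  qed
qed

end

section \<open>Equal layer sets\<close>

context minimal_optimal
begin

text \<open>As \<open>r = s = 2\<close>, the core \<open>P\<close> is a single point
  \<open>i\<close>. All partners contain \<open>i\<close>, so they lie in the star \<open>F\<close>,
  and lightness turns this inclusion into equality.\<close>

lemma star_if_layers_eq:
  assumes "R = S"
  shows "(R = {1, 2} \<or> R = {2}) \<and> (\<exists>i\<in>{1..n}. F = {C \<in> layers n R. i \<in> C} \<and> partners n t S F = F)"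
proof -
  obtain P where ts: "t = 1" "s = 2" "2 \<le> r" and P: "P \<subseteq> {1..n}" "card P = r - 1"
    and ins: "\<forall>z\<in>{1..n} - P. insert z P \<in> F"
    and all: "\<forall>D\<in>F. D = P \<or> (\<exists>z\<in>{1..n} - P. D = insert z P)"
    and hit: "\<forall>B\<in>partners n t S F. P \<inter> B \<noteq> {}" and P_F: "1 \<in> S \<longrightarrow> P \<in> F"
    using minimal_structure by (elim conjE exE) (rule that)
  have r2: "r = 2"
    using S_range[of r] r_in assms ts by auto
  then have "card P = 1"
    using P by simp
  then obtain i where i: "P = {i}"
    by (rule card_1_singletonE)
  have R: "R \<subseteq> {1, 2}" "2 \<in> R"
    using R_range ts r2 r_in by force+
  have star: "F = {C \<in> layers n R. i \<in> C}"
  proof (intro equalityI subsetI)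
    fix D assume "D \<in> F"
    then show "D \<in> {C \<in> layers n R. i \<in> C}"
      using all F_layer i by blast
  next
    fix C assume C: "C \<in> {C \<in> layers n R. i \<in> C}"
    then have Csub: "C \<subseteq> {1..n}" and cardC: "card C = 1 \<or> card C = 2" "card C \<in> R"
      using R by (auto simp: mem_layers_iff)
    show "C \<in> F"
    proof (cases "card C = 1")
      case True
      then have "C = P"
        using C i by (auto simp: card_1_singleton_iff)
      then show ?thesis
        using P_F cardC True assms by simp
    next
      case False
      then obtain z where "C = {z, i}" "z \<noteq> i"
        using cardC C by (auto simp: card_2_iff)
      then show ?thesis
        using ins Csub i by auto
    qed
  qed
  have "partners n t S F \<subseteq> F"
    using hit i star assms by (auto simp: partners_def)
  then have "partners n t S F = F"
    using F_finite opt(2) by (simp add: light_def card_seteq)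
  moreover have "i \<in> {1..n}"
    using P i by simp
  ultimately show ?thesis
    using R star by blast
qed

end

context layer_pair
begin

lemma optimal_card_1:
  assumes "optimal F" "card F = 1"
  shows "\<exists>C\<in>nsets {1..n} r. F = {C} \<and> partners n t S F = {B \<in> layers n S. t \<le> card (B \<inter> C)}"
proof -
  obtain C where C: "F = {C}"
    using assms(2) by (rule card_1_singletonE)
  then have "card C = r" "C \<in> layers n R"
    using assms optimal_singleton_card by (auto simp: optimal_def feasible_def)
  then have "C \<in> nsets {1..n} r"
    using layers_subset layers_finite by (simp add: nsets_def)
  then show ?thesis
    using C by (auto simp: partners_def Int_commute)
qed

lemma ex_minimal_optimal:
  assumes "optimal F" "light F" "card F \<noteq> 1" "t < s" "2 * r < n" "2 * s < n" "t < r \<or> 2 * r + 2 < n"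
  shows "\<exists>G. minimal_optimal n t r s R S G \<and> card G \<le> card F"
proof -
  have "2 \<le> card F"
    using assms feasible_pos[of F] by (auto simp: optimal_def)
  then obtain G where "optimal G \<and> light G \<and> 2 \<le> card G"
    and min: "\<And>H. optimal H \<and> light H \<and> 2 \<le> card H \<Longrightarrow> card G \<le> card H"
    using ex_has_least_nat[of "\<lambda>F. optimal F \<and> light F \<and> 2 \<le> card F" F card] assms by auto
  then have "minimal_optimal n t r s R S G"
    using assms by unfold_locales auto
  then show ?thesis
    using min \<open>2 \<le> card F\<close> assms by blast
qed

text \<open>A smallest such family \<open>G\<close> is a star equal to its partner family, so its
  total is \<open>2 * card G\<close>. Lightness gives \<open>2 * card F \<le> total F\<close>, and
  both totals agree; hence \<open>F\<close> is itself smallest and a star.\<close>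

lemma optimal_light_if_layers_eq:
  assumes RS: "R = S" and n: "2 * r < n" and F: "optimal F" "light F" and not1: "card F \<noteq> 1"
  shows "(R = {1, 2} \<or> R = {2}) \<and> (\<exists>i\<in>{1..n}. F = {C \<in> layers n R. i \<in> C} \<and> partners n t S F = F)"
proof -
  have rs: "r = s"
    using R_range[of s] S_range[of r] RS r_in s_in by auto
  have card2: "2 \<le> card F"
    using not1 F feasible_pos[of F] by (auto simp: optimal_def)
  \<comment> \<open>If \<open>t = r\<close>, then \<open>R = {t}\<close>, and a member can meet a
    partner \<open>B\<close> in \<open>t\<close> points only by being \<open>B\<close>, so there
    would be just one member.\<close>
  have t_r: "t < r"
  proof (rule ccontr)
    assume "\<not> t < r"
    then have R_eq: "R = {t}"
      using R_range r_in t_le_r by force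
    obtain B where B: "B \<in> partners n t S F"
      using F by (auto simp: optimal_def feasible_def)
    have F_sub: "F \<subseteq> layers n R"
      using F(1) by (simp add: optimal_def feasible_def)
    have "C = B" if C: "C \<in> F" for C
    proof -
      have "C \<in> layers n R" "B \<in> layers n R"
        using C B F_sub unfolding RS partners_def by blast+
      then have *: "finite C" "finite B" "card C = t" "card B = t"
        using layers_finite R_eq by (auto simp: mem_layers_iff)
      have "t \<le> card (C \<inter> B)"
        using B C by (auto simp: partners_def)
      then have "C \<inter> B = C"
        using * card_seteq[of C "C \<inter> B"] by simp
      then have "C \<subseteq> B"
        by blast
      then show ?thesis
        using * by (simp add: card_subset_eq)
    qed
    then have "F \<subseteq> {B}"
      by auto
    then have "card F \<le> 1"
      using card_mono[of "{B}" F] by simp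
    then show False
      using card2 by simp
  qed
  obtain G where G: "minimal_optimal n t r s R S G" and le: "card G \<le> card F"
    using ex_minimal_optimal[OF F not1] rs t_r n by auto
  interpret G: minimal_optimal n t r s R S G
    by (rule G)
  have "partners n t S G = G"
    using G.star_if_layers_eq[OF RS] by blast
  then have "total G = 2 * card G"
    by (simp add: total_def)
  moreover have "total F = total G"
    using F(1) G.opt(1) by (simp add: optimal_def order.antisym)
  ultimately have "total F = 2 * card G"
    by simp
  moreover have "2 * card F \<le> total F"
    using F by (simp add: total_def light_def)
  ultimately have eq: "card F = card G"
    using le by simp
  have "minimal_optimal n t r s R S F"
    using G.minimal eq F card2 G.t_less_s G.r_half G.s_half G.r_large by unfold_locales auto
  then show ?thesis
    using RS by (rule minimal_optimal.star_if_layers_eq)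
qed

end

section \<open>Values attained by stars and singletons\<close>

lemma card_star_2:
  assumes "i \<in> {1..n}"
  shows "card {C \<in> nsets {1..n} 2. i \<in> C} = n - 1"
proof -
  have "{C \<in> nsets {1..n} 2. i \<in> C} = (\<lambda>z. {i, z}) ` ({1..n} - {i})"
    using assms by (auto simp: nsets_def card_2_iff doubleton_eq_iff image_iff)
  moreover have "inj_on (\<lambda>z. {i, z}) ({1..n} - {i})"
    by (rule inj_onI) (auto simp: doubleton_eq_iff)
  ultimately show ?thesis
    using assms by (simp add: card_image)
qed

lemma card_star_1_2:
  assumes "i \<in> {1..n}"
  shows "card {C \<in> layers n {1..2}. i \<in> C} = n"
proof -
  have "{1..2} = {1, 2::nat}"
    by auto
  then have "{C \<in> layers n {1..2}. i \<in> C} = insert {i} {C \<in> nsets {1..n} 2. i \<in> C}"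
    using assms by (auto simp: layers_def nsets_def card_1_singleton_iff)
  moreover have "{i} \<notin> {C \<in> nsets {1..n} 2. i \<in> C}" "finite {C \<in> nsets {1..n} 2. i \<in> C}"
    by (auto simp: nsets_def finite_imp_finite_nsets)
  ultimately show ?thesis
    using assms card_star_2[OF assms] by simp
qed

lemma card_eq_bound_term:
  assumes "C \<in> nsets {1..n} k" "finite M"
  shows "card {C} + card {B \<in> layers n M. t \<le> card (B \<inter> C)} = bound_term n t k M"
proof -
  have "{B \<in> layers n M. t \<le> card (B \<inter> C)} = partners n t M {C}"
    by (auto simp: partners_def Int_commute)
  then show ?thesis
    using card_partners_singleton[of C n M t] assms by (auto simp: nsets_def)
qed

section \<open>Different layer sets\<close>

text \<open>Since \<open>i - j \<le> p \<le> N / 2\<close>, each second factor is at most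
  \<open>N choose p\<close>; the first factors are part of a row of Pascal's triangle.\<close>

lemma sum_choose_mult_choose_le:
  fixes N :: nat
  assumes "i \<le> t + p" "2 * p \<le> N"
  shows "(\<Sum>j=t..i. (k choose j) * (N choose (i - j))) \<le> 2 ^ k * (N choose p)"
proof -
  have "(\<Sum>j=t..i. (k choose j) * (N choose (i - j))) \<le> (\<Sum>j=t..i. (k choose j) * (N choose p))"
    using assms by (intro sum_mono mult_le_mono2 binomial_mono) auto
  also have "\<dots> = (\<Sum>j=t..i. k choose j) * (N choose p)"
    by (simp add: sum_distrib_right)
  also have "\<dots> \<le> 2 ^ k * (N choose p)"
  proof -
    \<comment> \<open>\<open>max i k\<close> covers indices beyond \<open>k\<close>, where the
      coefficients vanish.\<close>
    have "(\<Sum>j=t..i. k choose j) \<le> (\<Sum>j\<le>max i k. k choose j)"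
      by (intro sum_mono2) auto
    also have "\<dots> = (\<Sum>j\<le>k. k choose j)"
      by (intro sum.mono_neutral_right) auto
    finally show ?thesis
      by (simp add: choose_row_sum)
  qed
  finally show ?thesis .
qed

text \<open>Consecutive binomial coefficients have ratio \<open>(N - p) / (p + 1)\<close>;
  multiplying by \<open>Suc p\<close> keeps the argument in the naturals.\<close>

lemma mult_choose_less_choose_Suc:
  fixes N :: nat
  assumes "c * Suc p < N - p"
  shows "c * (N choose p) < N choose Suc p"
proof -
  have "Suc p * (c * (N choose p)) = (c * Suc p) * (N choose p)"
    by (simp only: mult_ac)
  also have "\<dots> < (N - p) * (N choose p)"
    using assms by (simp only: mult_less_cancel2) simp
  also have "\<dots> = Suc p * (N choose Suc p)"
    by (simp only: binomial_absorb_comp binomial_absorption)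
  finally show ?thesis
    by (simp only: mult_less_cancel1)
qed

context layer_pair
begin

text \<open>Let \<open>m\<close> be the largest size in which \<open>R\<close> and \<open>S\<close>
  differ. Sizes above \<open>m\<close> contribute equally, size \<open>m\<close> contributes only on
  the side of \<open>S\<close>, with order \<open>n ^ (m - t)\<close>, and the sizes of
  \<open>R\<close> below \<open>m\<close> contribute a lower order, which the hypothesis on
  \<open>n\<close> makes smaller.\<close>

lemma bound_term_less:
  assumes ne: "R \<noteq> S" and max: "Max (sym_diff R S) \<in> S"
    and n: "2 ^ (s + 1) * card R * (s - t) + 2 * r + 1 \<le> n" and s_half: "2 * s < n"
  shows "r \<le> s" "t < s" "bound_term n t s R < bound_term n t r S"
proof -
  define m where "m = Max (sym_diff R S)"
  have fin: "finite (sym_diff R S)"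
    using finite_R finite_S by simp
  have "sym_diff R S \<noteq> {}"
    using ne by blast
  then have "m \<in> sym_diff R S"
    unfolding m_def using Max_in[OF fin] by blast
  then have m: "m \<in> S" "m \<notin> R" "t \<le> m" "m \<le> s"
    using max S_range by (auto simp: m_def)
  have above: "i \<in> R \<longleftrightarrow> i \<in> S" if "m < i" for i
    using that Max_ge[OF fin, of i] by (force simp: m_def)
  show r_s: "r \<le> s"
    using above[of r] r_in m S_range by force
  show t_s: "t < s"
  proof (rule ccontr)
    assume "\<not> t < s"
    then have "R = {t}" "S = {t}"
      using R_range S_range r_in s_in r_s m by force+
    then show False using ne by simp
  qed
  \<comment> \<open>A size above \<open>m\<close> lies in both sets or in neither, so
    \<open>s\<close> lies in \<open>R\<close>. Hence the common sizes above \<open>m\<close>, if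
    any, are counted with the same parameter on both sides.\<close>
  have r_eq: "r = s" if "m < s"
    using above[OF that] s_in R_range[of s] r_s by auto
  define d where "d k i = (\<Sum>j=t..i. (k choose j) * ((n - k) choose (i - j)))" for k i
  define T where "T = {i \<in> R. m < i}"
  define L where "L = {i \<in> R. i < m}"
  have T_S: "T = {i \<in> S. m < i}"
    using above by (auto simp: T_def)
  have finTL: "finite T" "finite L"
    using finite_R by (auto simp: T_def L_def)
  have d_T: "d s i = d r i" if "i \<in> T" for i
  proof -
    have "m < s"
      using that T_S S_range[of i] by auto
    then show ?thesis using r_eq by simp
  qed
  have "i < m \<or> m < i" if "i \<in> R" for i
    using that m by (metis linorder_neqE_nat)
  then have "R = L \<union> T" "L \<inter> T = {}"
    by (auto simp: L_def T_def)
  then have sum_R: "(\<Sum>i\<in>R. d s i) = (\<Sum>i\<in>L. d s i) + (\<Sum>i\<in>T. d s i)"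
    using finTL by (simp add: sum.union_disjoint)
  have "(\<Sum>i\<in>insert m T. d r i) \<le> (\<Sum>i\<in>S. d r i)"
    using m T_S finite_S by (intro sum_mono2) auto
  moreover have "m \<notin> T"
    by (simp add: T_def)
  ultimately have sum_S: "d r m + (\<Sum>i\<in>T. d s i) \<le> (\<Sum>i\<in>S. d r i)"
    using finTL d_T by simp
  \<comment> \<open>The single summand \<open>j = t\<close> is enough as a lower bound.\<close>
  have "(r choose t) * ((n - r) choose (m - t)) \<le> d r m"
    unfolding d_def using m by (intro member_le_sum) auto
  moreover have "1 * ((n - r) choose (m - t)) \<le> (r choose t) * ((n - r) choose (m - t))"
    using t_le_r by (intro mult_le_mono1) (simp add: Suc_le_eq)
  ultimately have low: "(n - r) choose (m - t) \<le> d r m"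
    by linarith
  have "(\<Sum>i\<in>L. d s i) < d r m"
  proof (cases "L = {}")
    case True
    have "m - t \<le> n - r"
      using m sum_less by linarith
    then have "0 < (n - r) choose (m - t)"
      by simp
    then have "0 < d r m"
      using low by linarith
    then show ?thesis using True by simp
  next
    case False
    then obtain i0 where "i0 \<in> L"
      by blast
    then have "t < m"
      using R_range[of i0] by (auto simp: L_def)
    then obtain p where p: "m = t + Suc p"
      by (metis add_Suc_right less_imp_Suc_add)
    \<comment> \<open>Each size below \<open>m\<close> contributes at most \<open>2 ^ s\<close>
      times \<open>(n - s) choose p\<close>, and there are at most \<open>card R\<close> such
      sizes.\<close>
    define c where "c = 2 ^ s * card R"
    have "0 < card R"
      using finite_R r_in by (auto simp: card_gt_0_iff)
    then have c_ge: "2 ^ s \<le> c"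
      by (simp add: c_def)
    have "s - 1 < 2 ^ (s - 1)"
      by (rule less_exp)
    moreover have "(2::nat) ^ s = 2 * 2 ^ (s - 1)"
      using t_s by (cases s) auto
    ultimately have pow: "2 * s \<le> 2 ^ s"
      by linarith
    have "c * 1 \<le> c * (s - t)" and c_p: "c * Suc p \<le> c * (s - t)"
      using t_s p m by (intro mult_le_mono2; linarith)+
    then have c_s: "c \<le> c * (s - t)"
      by simp
    have n': "2 * (c * (s - t)) + 2 * r + 1 \<le> n"
      using n by (simp add: c_def mult.assoc)
    \<comment> \<open>Of the doubled term in \<open>n'\<close>, one copy dominates
      \<open>c * Suc p\<close> and the other dominates \<open>s + p\<close>.\<close>
    have "c * Suc p < n - s - p"
      using c_s c_p c_ge pow n' p m t_s by linarith
    then have "c * ((n - s) choose p) < (n - s) choose Suc p"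
      by (rule mult_choose_less_choose_Suc)
    also have "\<dots> \<le> (n - r) choose Suc p"
      using r_s by (intro binomial_right_mono) simp
    also have "\<dots> \<le> d r m"
      using low p by simp
    finally have small: "c * ((n - s) choose p) < d r m" .
    have "2 * p \<le> n - s"
      using c_s c_ge pow n' p m by linarith
    then have "d s i \<le> 2 ^ s * ((n - s) choose p)" if "i \<in> L" for i
      using that p unfolding d_def by (intro sum_choose_mult_choose_le) (auto simp: L_def)
    then have "(\<Sum>i\<in>L. d s i) \<le> card L * (2 ^ s * ((n - s) choose p))"
      by (intro order_trans[OF sum_bounded_above]) auto
    also have "\<dots> \<le> card R * (2 ^ s * ((n - s) choose p))"
      using finite_R by (intro mult_le_mono1 card_mono) (auto simp: L_def)
    finally show ?thesis
      using small by (simp add: c_def mult_ac)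
  qed
  then have "(\<Sum>i\<in>R. d s i) < (\<Sum>i\<in>S. d r i)"
    using sum_R sum_S by linarith
  then show "bound_term n t s R < bound_term n t r S"
    by (simp add: bound_term_def d_def)
qed

text \<open>Since the two terms differ strictly, a family attaining the larger one is light;
  otherwise its total would be the smaller one. Two or more members are then excluded by
  \<open>minimal_structure\<close>.\<close>

lemma equality_iff_if_layers_ne:
  assumes ne: "R \<noteq> S" and max: "Max (sym_diff R S) \<in> S"
    and n: "2 ^ (s + 1) * card R * (s - t) + 2 * r + 1 \<le> n" and s_half: "2 * s < n"
    and FG: "F \<subseteq> layers n R" "G \<subseteq> layers n S" "nonempty_cross_intersecting t F G"
  shows "card F + card G = max (bound_term n t r S) (bound_term n t s R) \<longleftrightarrow>
    (\<exists>A\<in>nsets {1..n} r. F = {A} \<and> G = {B \<in> layers n S. t \<le> card (B \<inter> A)})"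
proof
  note less = bound_term_less[OF ne max n s_half]
  show "card F + card G = max (bound_term n t r S) (bound_term n t s R)"
    if "\<exists>A\<in>nsets {1..n} r. F = {A} \<and> G = {B \<in> layers n S. t \<le> card (B \<inter> A)}"
    using that less(3) card_eq_bound_term[OF _ finite_S] by auto
  assume "card F + card G = max (bound_term n t r S) (bound_term n t s R)"
  note F = cross_intersecting_equality[OF FG this]
  interpret sw: layer_pair n t s r S R
    by (rule swap)
  have light: "light F"
  proof (rule ccontr)
    assume "\<not> light F"
    then have "sw.light (partners n t S F)"
      using optimal_swap[OF F(1)] by (simp add: light_def sw.light_def)
    then have "total F = bound_term n t s R"
      using sw.optimal_light_total optimal_swap[OF F(1)] by simp
    then show False
      using F(3) less(3) by simp
  qed
  have "card F = 1"
  proof (rule ccontr)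
    assume not1: "card F \<noteq> 1"
    \<comment> \<open>The hypothesis on \<open>n\<close> exceeds \<open>2 * r + 1\<close> by at
      least 4, which supplies \<open>r_large\<close>.\<close>
    have "0 < card R"
      using finite_R r_in by (auto simp: card_gt_0_iff)
    then have "2 ^ (s + 1) * 1 * 1 \<le> 2 ^ (s + 1) * card R * (s - t)"
      using less(2) by (intro mult_le_mono) auto
    moreover have "(2::nat) ^ 2 \<le> 2 ^ (s + 1)"
      using less(2) by (intro power_increasing) auto
    then have "(4::nat) \<le> 2 ^ (s + 1) * 1 * 1"
      by simp
    ultimately have "4 \<le> 2 ^ (s + 1) * card R * (s - t)"
      by (rule order_trans[rotated])
    then have big: "2 * r + 2 < n"
      using n by linarith
    obtain H where "minimal_optimal n t r s R S H"
      using ex_minimal_optimal[OF F(1) light not1 less(2) _ s_half] big by auto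
    then interpret H: minimal_optimal n t r s R S H .
    \<comment> \<open>The structure forces \<open>R = {2}\<close> and \<open>S = {1, 2}\<close>. But
      \<open>1 \<in> S\<close> puts the 1-set \<open>P\<close> into the family, although
      \<open>1 \<notin> R\<close>.\<close>
    have ts: "t = 1" "s = 2" "r = 2"
      using H.minimal_structure less(1) by auto
    have "2 \<in> R" "2 \<in> S"
      using r_in s_in ts by auto
    moreover have "R \<subseteq> {1, 2}" "S \<subseteq> {1, 2}"
      using R_range S_range ts by force+
    moreover have "Max (sym_diff R S) \<notin> R"
      using Max_in[of "sym_diff R S"] finite_R finite_S ne max by blast
    ultimately have S1: "1 \<in> S" "1 \<notin> R"
      using max by auto
    then obtain P where P: "P \<in> H" "card P = 1"
      using H.minimal_structure ts by auto
    then have "P \<in> layers n R"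
      using H.F_layer by blast
    then show False
      using P S1 by (simp add: mem_layers_iff)
  qed
  then show "\<exists>A\<in>nsets {1..n} r. F = {A} \<and> G = {B \<in> layers n S. t \<le> card (B \<inter> A)}"
    using optimal_card_1[OF F(1)] F(2) by simp
qed

text \<open>Either \<open>F\<close> or its partner family \<open>G\<close> is light, and the light
  one is a singleton or a star.\<close>

lemma equality_cases_if_layers_eq:
  assumes RS: "R = S" and n: "2 * r < n"
    and FG: "F \<subseteq> layers n R" "G \<subseteq> layers n S" "nonempty_cross_intersecting t F G"
    and eq: "card F + card G = max (bound_term n t r S) (bound_term n t s R)"
  shows "(\<exists>A\<in>nsets {1..n} r. F = {A} \<and> G = {B \<in> layers n S. t \<le> card (B \<inter> A)})
    \<or> (\<exists>B\<in>nsets {1..n} s. G = {B} \<and> F = {A \<in> layers n R. t \<le> card (A \<inter> B)})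
    \<or> (R = {1, 2} \<or> R = {2}) \<and> (\<exists>i\<in>{1..n}. F = {C \<in> layers n R. i \<in> C} \<and> G = {C \<in> layers n R. i \<in> C})"
proof -
  interpret sw: layer_pair n t s r S R
    by (rule swap)
  have rs: "r = s"
    using R_range[of s] S_range[of r] RS r_in s_in by auto
  note F = cross_intersecting_equality[OF FG eq]
  note G = optimal_swap[OF F(1), folded F(2)]
  show ?thesis
  proof (cases "light F")
    case True
    then show ?thesis
      using optimal_card_1[OF F(1)] optimal_light_if_layers_eq[OF RS n F(1)] F(2)
      by (cases "card F = 1") auto
  next
    case False
    then have "sw.light G"
      using G(2) F(2) by (simp add: light_def sw.light_def)
    then show ?thesis
      using sw.optimal_card_1[OF G(1)] sw.optimal_light_if_layers_eq[OF RS[symmetric] _ G(1)] G(2) n rs RS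
      by (cases "card G = 1") auto
  qed
qed

end

section \<open>Assembling the bound and the equality cases\<close>

theorem theorem1p1:
  fixes n r s t :: nat and R S :: "nat set" and \<A> \<B> :: "nat set set"
  assumes pos: "0 < n" "0 < r" "0 < s" "0 < t"
    and RS: "R \<subseteq> {1..n}" "S \<subseteq> {1..n}" "R \<noteq> {}" "S \<noteq> {}"
    and t_le: "t \<le> Min (R \<union> S)"
    and r_eq: "r = Max R" and s_eq: "s = Max S"
    and less_n: "int r + int s - int t < int n"
    and fam: "\<A> \<subseteq> layers n R" "\<B> \<subseteq> layers n S"
    and cross: "nonempty_cross_intersecting t \<A> \<B>"
  shows
    "card \<A> + card \<B> \<le> max (bound_term n t r S) (bound_term n t s R)
     \<and>
     (R = S \<and> 2 * r < n \<longrightarrow>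
        (card \<A> + card \<B> = max (bound_term n t r S) (bound_term n t s R) \<longleftrightarrow>
          (\<exists>A \<in> nsets {1..n} r. \<A> = {A} \<and> \<B> = {B \<in> layers n S. t \<le> card (B \<inter> A)})
        \<or> (\<exists>B \<in> nsets {1..n} s. \<B> = {B} \<and> \<A> = {A \<in> layers n R. t \<le> card (A \<inter> B)})
        \<or> (R = {1, 2} \<and> S = {1, 2} \<and>
            (\<exists>i \<in> {1..n}. \<A> = {C \<in> layers n {1..2}. i \<in> C} \<and> \<B> = {C \<in> layers n {1..2}. i \<in> C}))
        \<or> (R = {2} \<and> S = {2} \<and>
            (\<exists>i \<in> {1..n}. \<A> = {C \<in> nsets {1..n} 2. i \<in> C} \<and> \<B> = {C \<in> nsets {1..n} 2. i \<in> C}))))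
     \<and>
     (R \<noteq> S \<and>
      max (2 ^ (s + 1) * card R * (s - t) + 2 * r + 1)
          (2 ^ (r + 1) * card S * (r - t) + 2 * s + 1) \<le> n \<longrightarrow>
        (card \<A> + card \<B> = max (bound_term n t r S) (bound_term n t s R) \<longleftrightarrow>
          (Max (sym_diff R S) \<in> S \<and>
            (\<exists>A \<in> nsets {1..n} r. \<A> = {A} \<and> \<B> = {B \<in> layers n S. t \<le> card (B \<inter> A)}))
        \<or> (Max (sym_diff R S) \<in> R \<and>
            (\<exists>B \<in> nsets {1..n} s. \<B> = {B} \<and> \<A> = {A \<in> layers n R. t \<le> card (A \<inter> B)}))))"
proof -
  have fin: "finite R" "finite S"
    using RS finite_subset by blast+
  have t_all: "t \<le> i" if "i \<in> R \<union> S" for i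
    using order_trans[OF t_le Min_le[OF _ that]] fin by simp
  interpret layer_pair n t r s R S
  proof
    show "0 < t" "r \<in> R" "s \<in> S" "r + s < n + t"
      using pos r_eq s_eq fin RS less_n by auto
    show "t \<le> i \<and> i \<le> r" if "i \<in> R" for i
      using that t_all r_eq fin by simp
    show "t \<le> i \<and> i \<le> s" if "i \<in> S" for i
      using that t_all s_eq fin by simp
  qed
  interpret sw: layer_pair n t s r S R
    by (rule swap)
  have cross': "nonempty_cross_intersecting t \<B> \<A>"
    using cross unfolding nonempty_cross_intersecting_def by (metis Int_commute)
  let ?eq = "card \<A> + card \<B> = max (bound_term n t r S) (bound_term n t s R)"
  let ?A = "\<exists>A \<in> nsets {1..n} r. \<A> = {A} \<and> \<B> = {B \<in> layers n S. t \<le> card (B \<inter> A)}"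
  let ?B = "\<exists>B \<in> nsets {1..n} s. \<B> = {B} \<and> \<A> = {A \<in> layers n R. t \<le> card (A \<inter> B)}"
  let ?star12 = "R = {1, 2} \<and> S = {1, 2} \<and>
    (\<exists>i \<in> {1..n}. \<A> = {C \<in> layers n {1..2}. i \<in> C} \<and> \<B> = {C \<in> layers n {1..2}. i \<in> C})"
  let ?star2 = "R = {2} \<and> S = {2} \<and>
    (\<exists>i \<in> {1..n}. \<A> = {C \<in> nsets {1..n} 2. i \<in> C} \<and> \<B> = {C \<in> nsets {1..n} 2. i \<in> C})"
  have "?eq \<longleftrightarrow> ?A \<or> ?B \<or> ?star12 \<or> ?star2" if eq: "R = S" and n: "2 * r < n"
  proof
    have l12: "layers n {1, 2} = layers n {1..2}"
      by (rule arg_cong[where f = "layers n"]) auto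
    have l2: "layers n {2} = nsets {1..n} 2"
      by (simp add: layers_def)
    assume ?eq
    from equality_cases_if_layers_eq[OF eq n fam cross this]
    consider ?A | ?B | "R = {1, 2}" "\<exists>i\<in>{1..n}. \<A> = {C \<in> layers n R. i \<in> C} \<and> \<B> = {C \<in> layers n R. i \<in> C}"
      | "R = {2}" "\<exists>i\<in>{1..n}. \<A> = {C \<in> layers n R. i \<in> C} \<and> \<B> = {C \<in> layers n R. i \<in> C}"
      by blast
    then show "?A \<or> ?B \<or> ?star12 \<or> ?star2"
    proof cases
      case 3
      then have ?star12
        using eq l12 by simp
      then show ?thesis by blast
    next
      case 4
      then have ?star2
        using eq l2 by simp
      then show ?thesis by blast
    qed blast+
  next
    have rs: "s = r"
      using eq r_eq s_eq by simp
    assume "?A \<or> ?B \<or> ?star12 \<or> ?star2"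
    then consider ?A | ?B | ?star12 | ?star2
      by blast
    then show ?eq
    proof cases
      case 1
      then show ?thesis
        using card_eq_bound_term[OF _ fin(2)] eq rs by auto
    next
      case 2
      then show ?thesis
        using card_eq_bound_term[OF _ fin(1)] eq rs by (auto simp: add.commute)
    next
      case 3
      then obtain i where i: "i \<in> {1..n}" "\<A> = {C \<in> layers n {1..2}. i \<in> C}" "\<B> = {C \<in> layers n {1..2}. i \<in> C}"
        by blast
      \<comment> \<open>With these values both bound terms equal \<open>2 * n\<close>, twice the
        size of the star.\<close>
      have "r = 2" "t = 1"
        using 3 r_eq t_all[of 1] pos by auto
      then show ?thesis
        using 3 i(2,3) card_star_1_2[OF i(1)] rs n by (simp add: bound_term_def numeral_2_eq_2)
    next
      case 4
      then obtain i where i: "i \<in> {1..n}" "\<A> = {C \<in> nsets {1..n} 2. i \<in> C}" "\<B> = {C \<in> nsets {1..n} 2. i \<in> C}"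
        by blast
      have r2: "r = 2" "t = 1 \<or> t = 2"
        using 4 r_eq t_all[of 2] pos by auto
      \<comment> \<open>\<open>t = 2\<close> is excluded by cross-intersection: since
        \<open>n > 4\<close>, the star has two members that share only \<open>i\<close>.\<close>
      have "card ({1..n} - {i}) = n - 1"
        using i by simp
      then have "\<not> card ({1..n} - {i}) \<le> 1"
        using n r2 by simp
      then obtain a b where ab: "a \<in> {1..n} - {i}" "b \<in> {1..n} - {i}" "a \<noteq> b"
        by (metis One_nat_def card_le_Suc0_iff_eq finite_Diff finite_atLeastAtMost)
      then have "{i, a} \<in> \<A>" "{i, b} \<in> \<B>"
        using i by auto
      then have "t \<le> card ({i, a} \<inter> {i, b})"
        using cross unfolding nonempty_cross_intersecting_def by blast
      moreover have "{i, a} \<inter> {i, b} = {i}"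
        using ab by auto
      ultimately have "t \<le> card {i}"
        by (simp only:)
      then have "t = 1"
        using r2 by auto
      then show ?thesis
        using 4 i(2,3) card_star_2[OF i(1)] rs n r2 by (simp add: bound_term_def numeral_2_eq_2)
    qed
  qed
  moreover have "?eq \<longleftrightarrow> Max (sym_diff R S) \<in> S \<and> ?A \<or> Max (sym_diff R S) \<in> R \<and> ?B"
    if ne: "R \<noteq> S" and n: "max (2 ^ (s + 1) * card R * (s - t) + 2 * r + 1)
          (2 ^ (r + 1) * card S * (r - t) + 2 * s + 1) \<le> n"
  proof -
    have half: "2 * r < n" "2 * s < n"
      using n by simp_all
    have sym: "sym_diff S R = sym_diff R S"
      by blast
    have "Max (sym_diff R S) \<in> sym_diff R S"
      using ne fin by (intro Max_in) auto
    then consider "Max (sym_diff R S) \<in> S" "Max (sym_diff R S) \<notin> R"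
      | "Max (sym_diff R S) \<in> R" "Max (sym_diff R S) \<notin> S"
      by blast
    then show ?thesis
    proof cases
      case 1
      then show ?thesis
        using equality_iff_if_layers_ne[OF ne 1(1) _ half(2) fam cross] n by simp
    next
      case 2
      have "card \<B> + card \<A> = max (bound_term n t s R) (bound_term n t r S) \<longleftrightarrow> ?B"
        using sw.equality_iff_if_layers_ne[OF ne[symmetric] _ _ half(1) fam(2,1) cross'] 2 n sym by simp
      then show ?thesis
        using 2 by (simp add: add.commute max.commute)
    qed
  qed
  ultimately show ?thesis
    using cross_intersecting_bound[OF fam cross] by (intro conjI impI) simp_all
qed

end
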